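(* There is an isomorphism of right $\mathsf{PlanEq}$-modules $\mathsf{CycPerm}\cong\mathsf{CycEq}\oplus(\overline{\mathsf{CycHam}}\circ\mathsf{PlanEq})$.
   Context: Graphs are finite, simple, undirected; a tube is a nonempty vertex set inducing a connected subgraph; $\Gamma/G$ contracts a tube to a vertex $\{G\}$; for a partition $I$ of $V_\Gamma$ into tubes, $\Gamma/I$ is the contracted graph on the blocks. $\overline{\Gamma}$ is the complement graph; $\mathsf{P}_1$ is the one-vertex graph. Over a field $\mathsf{k}$, collections are indexed by nonempty connected graphs, functorial in isomorphisms; $(\mathcal{V}\circ\mathcal{P})(\Gamma)=\bigoplus_I\mathcal{V}(\Gamma/I)\otimes\bigotimes_{G\in I}\mathcal{P}(\Gamma|_G)$ is the free right $\mathcal{P}$-module on $\mathcal{V}$ for a contractad $\mathcal{P}$. $\mathsf{PlanEq}(\Gamma)$ has basis the orderings $(v_1,\dots,v_n)$ of $V_\Gamma$ that are left-to-right leaf sequences of $\Gamma$-admissible planar binary trees (planar rooted trees with binary internal vertices, leaves labelled bijectively by $V_\Gamma$, leaf set below each vertex a tube), a contractad under substitution of sequences. $\mathsf{CycPerm}(\Gamma)$ has basis all cyclic orderings $[v_1,\dots,v_n]$ of $V_\Gamma$ (orderings modulo rotation), a right $\mathsf{PlanEq}$-module by substituting a sequence of $\Gamma|_G$ for $\{G\}$. $\mathsf{CycEq}(\Gamma)\subseteq\mathsf{CycPerm}(\Gamma)$ is spanned by the cyclic orderings having a representative in $\mathsf{PlanEq}(\Gamma)$ (a submodule). $\overline{\mathsf{CycHam}}(\Gamma)$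 is the vector space with basis the directed Hamiltonian cycles of $\overline{\Gamma}$ (cyclic orderings in which no two cyclically consecutive vertices are adjacent in $\Gamma$), with the convention $\overline{\mathsf{CycHam}}(\mathsf{P}_1)=0$. *)

theory Defs
  imports
    "HOL-Library.FSet"
    "HOL-Library.FuncSet"
    "HOL-Library.Disjoint_Sets"
    "HOL-Library.Poly_Mapping"
    "HOL-Library.Product_Plus"
begin

section \<open>Graphs, tubes and contractions\<close>

record 'v graph =
  verts :: "'v set"
  edges :: "'v set set"

definition simple_graph :: "'v graph \<Rightarrow> bool" where
  "simple_graph \<Gamma> \<longleftrightarrow> finite (verts \<Gamma>) \<and>
     (\<forall>e\<in>edges \<Gamma>. \<exists>u\<in>verts \<Gamma>. \<exists>v\<in>verts \<Gamma>. u \<noteq> v \<and> e = {u, v})"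

definition connected_graph :: "'v graph \<Rightarrow> bool" where
  "connected_graph \<Gamma> \<longleftrightarrow> simple_graph \<Gamma> \<and> verts \<Gamma> \<noteq> {} \<and>
     (\<forall>u\<in>verts \<Gamma>. \<forall>v\<in>verts \<Gamma>. (u, v) \<in> {(x, y). {x, y} \<in> edges \<Gamma>}\<^sup>*)"

definition induced :: "'v graph \<Rightarrow> 'v set \<Rightarrow> 'v graph" where
  "induced \<Gamma> S = \<lparr>verts = S, edges = {e \<in> edges \<Gamma>. e \<subseteq> S}\<rparr>"

definition complement :: "'v graph \<Rightarrow> 'v graph" where
  "complement \<Gamma> = \<lparr>verts = verts \<Gamma>,
     edges = {{u, v} |u v. u \<in> verts \<Gamma> \<and> v \<in> verts \<Gamma> \<and> u \<noteq> v \<and> {u, v} \<notin> edges \<Gamma>}\<rparr>"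

definition graph_iso :: "('v \<Rightarrow> 'w) \<Rightarrow> 'v graph \<Rightarrow> 'w graph \<Rightarrow> bool" where
  "graph_iso f \<Gamma> \<Delta> \<longleftrightarrow> bij_betw f (verts \<Gamma>) (verts \<Delta>) \<and>
     (\<forall>u\<in>verts \<Gamma>. \<forall>v\<in>verts \<Gamma>. {u, v} \<in> edges \<Gamma> \<longleftrightarrow> {f u, f v} \<in> edges \<Delta>)"

definition tube :: "'v graph \<Rightarrow> 'v set \<Rightarrow> bool" where
  "tube \<Gamma> G \<longleftrightarrow> G \<subseteq> verts \<Gamma> \<and> G \<noteq> {} \<and> connected_graph (induced \<Gamma> G)"

definition tube_partition :: "'v graph \<Rightarrow> 'v set set \<Rightarrow> bool" where
  "tube_partition \<Gamma> I \<longleftrightarrow> partition_on (verts \<Gamma>) I \<and> (\<forall>G\<in>I. tube \<Gamma> G)"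

text \<open>
  A universe of vertex labels closed under forming blocks: a graph and all its iterated
  contractions have vertices in the same type, so that a collection (a functor on connected
  graphs) can be a single HOL function.  The type is infinite for every \<open>'a\<close>, hence every finite
  graph is isomorphic to one with vertices in it.
\<close>

datatype 'a vert = Atom 'a | Block "'a vert fset"

type_synonym 'a vgraph = "'a vert graph"

text \<open>\<open>blk G\<close> is the vertex $\{G\}$ of a contracted graph, for finite \<open>G\<close>; \<open>unblk\<close> is its inverse.\<close>

definition blk :: "'a vert set \<Rightarrow> 'a vert" where
  "blk G = Block (Abs_fset G)"

fun unblk :: "'a vert \<Rightarrow> 'a vert set" where
  "unblk (Block F) = fset F"
| "unblk (Atom a) = {}"

text \<open>
  The contracted graph $\Gamma/I$.  The contraction of a single tube \<open>G\<close> is the case where all other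
  blocks of \<open>I\<close> are singletons; such a vertex \<open>v\<close> then becomes \<open>blk {v}\<close>, which avoids clashes
  with \<open>blk G\<close>.
\<close>

definition contract :: "'a vgraph \<Rightarrow> 'a vert set set \<Rightarrow> 'a vgraph" where
  "contract \<Gamma> I = \<lparr>verts = blk ` I,
     edges = {{blk G, blk H} |G H. G \<in> I \<and> H \<in> I \<and> G \<noteq> H \<and>
                                   (\<exists>u\<in>G. \<exists>v\<in>H. {u, v} \<in> edges \<Gamma>)}\<rparr>"

definition on_blocks :: "('a vert set \<Rightarrow> 'a vert set) \<Rightarrow> 'a vert \<Rightarrow> 'a vert" where
  "on_blocks h v = blk (h (unblk v))"

text \<open>
  A block of a partition of $\Gamma/I$ is a set of blocks of \<open>I\<close>; \<open>flatten\<close> turns it into the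
  corresponding set of vertices of $\Gamma$.
\<close>

definition flatten :: "'a vert set \<Rightarrow> 'a vert set" where
  "flatten C = (\<Union>v\<in>C. unblk v)"


section \<open>Linear right modules and their isomorphisms\<close>

text \<open>
  The data of a right module over a contractad: a vector space for each connected graph, the
  transport along graph isomorphisms, and the structure map
  \[ M(\Gamma/I) \otimes \bigotimes_{G \in I} P(\Gamma|_G) \to M(\Gamma), \]
  given as a multilinear function \<open>act M \<Gamma> I m p\<close> of \<open>m\<close> and of the family \<open>(p G)\<close> for \<open>G \<in> I\<close>.
  A contractad is given by the same data, with its composition as action on itself; its unit plays
  no role in the notion of a module morphism.
\<close>

record ('a, 'k, 'm, 'p) rmodule =
  space :: "'a vgraph \<Rightarrow> 'm set"
  scale :: "'k \<Rightarrow> 'm \<Rightarrow> 'm"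
  transport :: "('a vert \<Rightarrow> 'a vert) \<Rightarrow> 'm \<Rightarrow> 'm"
  act :: "'a vgraph \<Rightarrow> 'a vert set set \<Rightarrow> 'm \<Rightarrow> ('a vert set \<Rightarrow> 'p) \<Rightarrow> 'm"

type_synonym ('a, 'k, 'p) contractad = "('a, 'k, 'p, 'p) rmodule"

definition is_rmodule_iso ::
  "('a, 'k, 'p) contractad \<Rightarrow> ('a, 'k, 'm::ab_group_add, 'p) rmodule \<Rightarrow>
   ('a, 'k, 'n::ab_group_add, 'p) rmodule \<Rightarrow> ('a vgraph \<Rightarrow> 'm \<Rightarrow> 'n) \<Rightarrow> bool" where
  "is_rmodule_iso P M N \<Phi> \<longleftrightarrow>
     (\<forall>\<Gamma>. connected_graph \<Gamma> \<longrightarrow>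
        bij_betw (\<Phi> \<Gamma>) (space M \<Gamma>) (space N \<Gamma>) \<and>
        (\<forall>x\<in>space M \<Gamma>. \<forall>y\<in>space M \<Gamma>. \<Phi> \<Gamma> (x + y) = \<Phi> \<Gamma> x + \<Phi> \<Gamma> y) \<and>
        (\<forall>c. \<forall>x\<in>space M \<Gamma>. \<Phi> \<Gamma> (scale M c x) = scale N c (\<Phi> \<Gamma> x))) \<and>
     (\<forall>\<Gamma> \<Delta> f. connected_graph \<Gamma> \<and> connected_graph \<Delta> \<and> graph_iso f \<Gamma> \<Delta> \<longrightarrow>
        (\<forall>x\<in>space M \<Gamma>. \<Phi> \<Delta> (transport M f x) = transport N f (\<Phi> \<Gamma> x))) \<and>
     (\<forall>\<Gamma> I. connected_graph \<Gamma> \<and> tube_partition \<Gamma> I \<longrightarrow>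
        (\<forall>m\<in>space M (contract \<Gamma> I). \<forall>p. (\<forall>G\<in>I. p G \<in> space P (induced \<Gamma> G)) \<longrightarrow>
           \<Phi> \<Gamma> (act M \<Gamma> I m p) = act N \<Gamma> I (\<Phi> (contract \<Gamma> I) m) p))"

definition rmodule_isomorphic ::
  "('a, 'k, 'p) contractad \<Rightarrow> ('a, 'k, 'm::ab_group_add, 'p) rmodule \<Rightarrow>
   ('a, 'k, 'n::ab_group_add, 'p) rmodule \<Rightarrow> bool" where
  "rmodule_isomorphic P M N \<longleftrightarrow> (\<exists>\<Phi>. is_rmodule_iso P M N \<Phi>)"

definition direct_sum ::
  "('a, 'k, 'm, 'p) rmodule \<Rightarrow> ('a, 'k, 'n, 'p) rmodule \<Rightarrow> ('a, 'k, 'm \<times> 'n, 'p) rmodule" where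
  "direct_sum M N = \<lparr>
     space = (\<lambda>\<Gamma>. space M \<Gamma> \<times> space N \<Gamma>),
     scale = (\<lambda>c (x, y). (scale M c x, scale N c y)),
     transport = (\<lambda>f (x, y). (transport M f x, transport N f y)),
     act = (\<lambda>\<Gamma> I (x, y) p. (act M \<Gamma> I x p, act N \<Gamma> I y p))\<rparr>"


section \<open>Collections and modules with a distinguished basis\<close>

record ('a, 'x) bcollection =
  basis :: "'a vgraph \<Rightarrow> 'x set"
  relabel :: "('a vert \<Rightarrow> 'a vert) \<Rightarrow> 'x \<Rightarrow> 'x"

record ('a, 'x, 'q) bmodule = "('a, 'x) bcollection" +
  bact :: "'a vgraph \<Rightarrow> 'a vert set set \<Rightarrow> 'x \<Rightarrow> ('a vert set \<Rightarrow> 'q) \<Rightarrow> 'x"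

type_synonym ('a, 'q) bcontractad = "('a, 'q, 'q) bmodule"

definition free_scale :: "'k::field \<Rightarrow> ('x \<Rightarrow>\<^sub>0 'k) \<Rightarrow> ('x \<Rightarrow>\<^sub>0 'k)" where
  "free_scale c f = Poly_Mapping.map (\<lambda>a. c * a) f"

text \<open>
  The spaces of \<open>linearize M\<close> are the vector spaces with bases \<open>basis M \<Gamma>\<close>; transport and action
  are the linear and multilinear extensions of those given on basis elements.
\<close>

definition linearize ::
  "('a, 'x, 'q) bmodule \<Rightarrow> ('a, 'k::field, 'x \<Rightarrow>\<^sub>0 'k, 'q \<Rightarrow>\<^sub>0 'k) rmodule" where
  "linearize M = \<lparr>
     space = (\<lambda>\<Gamma>. {m. Poly_Mapping.keys m \<subseteq> basis M \<Gamma>}),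
     scale = free_scale,
     transport = (\<lambda>f m. \<Sum>x\<in>Poly_Mapping.keys m.
       Poly_Mapping.single (relabel M f x) (Poly_Mapping.lookup m x)),
     act = (\<lambda>\<Gamma> I m p.
       \<Sum>x\<in>Poly_Mapping.keys m. \<Sum>s\<in>(\<Pi>\<^sub>E G\<in>I. Poly_Mapping.keys (p G)).
         Poly_Mapping.single (bact M \<Gamma> I x s)
           (Poly_Mapping.lookup m x * (\<Prod>G\<in>I. Poly_Mapping.lookup (p G) (s G))))\<rparr>"

text \<open>
  The free right module on \<open>V\<close>.  The space
  $(V \circ P)(\Gamma) = \bigoplus_I V(\Gamma/I) \otimes \bigotimes_{G \in I} P(\Gamma|_G)$
  has as basis the triples \<open>(I, c, s)\<close> of a partition \<open>I\<close> into tubes, a basis element \<open>c\<close> of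
  $V(\Gamma/I)$ and a family \<open>s\<close> of basis elements of the $P(\Gamma|_G)$.  The action is
  $(V \circ P) \circ P \cong V \circ (P \circ P) \to V \circ P$: given \<open>(J, c, s)\<close> over $\Gamma/I$ and \<open>p\<close>
  over the blocks of \<open>I\<close>, the partition \<open>J\<close> is flattened to one of $\Gamma$, the element \<open>c\<close> is
  transported along $(\Gamma/I)/J \cong \Gamma/\mathit{flatten}(J)$, and each \<open>s C\<close> is composed with the
  part of \<open>p\<close> lying over \<open>C\<close>.
\<close>

definition composite ::
  "('a, 'x) bcollection \<Rightarrow> ('a, 'q) bcontractad \<Rightarrow>
   ('a, 'a vert set set \<times> 'x \<times> ('a vert set \<Rightarrow> 'q), 'q) bmodule" where
  "composite V P = \<lparr>
     basis = (\<lambda>\<Gamma>. {(I, c, s). tube_partition \<Gamma> I \<and> c \<in> basis V (contract \<Gamma> I) \<and>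
                                s \<in> (\<Pi>\<^sub>E G\<in>I. basis P (induced \<Gamma> G))}),
     relabel = (\<lambda>f (I, c, s).
       ((`) f ` I,
        relabel V (on_blocks ((`) f)) c,
        \<lambda>H\<in>(`) f ` I. relabel P f (s (inv_into I ((`) f) H)))),
     bact = (\<lambda>\<Gamma> I (J, c, s) p.
       (flatten ` J,
        relabel V (on_blocks flatten) c,
        \<lambda>H\<in>flatten ` J.
          let C = inv_into J flatten H; I' = {G \<in> I. blk G \<in> C}
          in bact P (induced \<Gamma> H) I' (s C) (restrict p I')))\<rparr>"


section \<open>Linear and cyclic orderings\<close>

datatype 'v ptree = Leaf 'v | Node "'v ptree" "'v ptree"

fun leaves :: "'v ptree \<Rightarrow> 'v list" where
  "leaves (Leaf v) = [v]"
| "leaves (Node l r) = leaves l @ leaves r"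

fun subtree_tubes :: "'v graph \<Rightarrow> 'v ptree \<Rightarrow> bool" where
  "subtree_tubes \<Gamma> (Leaf v) \<longleftrightarrow> tube \<Gamma> {v}"
| "subtree_tubes \<Gamma> (Node l r) \<longleftrightarrow>
     tube \<Gamma> (set (leaves (Node l r))) \<and> subtree_tubes \<Gamma> l \<and> subtree_tubes \<Gamma> r"

definition orderings :: "'v graph \<Rightarrow> 'v list set" where
  "orderings \<Gamma> = {xs. distinct xs \<and> set xs = verts \<Gamma>}"

definition admissible_tree :: "'v graph \<Rightarrow> 'v ptree \<Rightarrow> bool" where
  "admissible_tree \<Gamma> t \<longleftrightarrow> leaves t \<in> orderings \<Gamma> \<and> subtree_tubes \<Gamma> t"

definition plan_orderings :: "'v graph \<Rightarrow> 'v list set" where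
  "plan_orderings \<Gamma> = {leaves t |t. admissible_tree \<Gamma> t}"

definition cyc :: "'v list \<Rightarrow> 'v list set" where
  "cyc xs = {rotate n xs |n. True}"

definition cyclic_orderings :: "'v graph \<Rightarrow> 'v list set set" where
  "cyclic_orderings \<Gamma> = cyc ` orderings \<Gamma>"

definition ham_cycles :: "'v graph \<Rightarrow> 'v list set set" where
  "ham_cycles \<Gamma> = {cyc xs |xs. xs \<in> orderings \<Gamma> \<and>
     (\<forall>i<length xs. {xs ! i, xs ! (Suc i mod length xs)} \<in> edges \<Gamma>)}"

text \<open>Substitution of the sequence \<open>s G\<close> for the vertex \<open>blk G\<close>, for all blocks \<open>G\<close> at once.\<close>

definition subst_list :: "'a vert list \<Rightarrow> ('a vert set \<Rightarrow> 'a vert list) \<Rightarrow> 'a vert list" where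
  "subst_list xs s = concat (map (\<lambda>v. s (unblk v)) xs)"

definition subst_cyc ::
  "'a vert list set \<Rightarrow> ('a vert set \<Rightarrow> 'a vert list) \<Rightarrow> 'a vert list set" where
  "subst_cyc c s = (\<Union>xs\<in>c. cyc (subst_list xs s))"

lemma cyc_rotate: "cyc (rotate n xs) = cyc xs"
proof -
  have "rotate k xs \<in> cyc (rotate n xs)" for k
  proof -
    define l where "l = k + (length xs - n mod length xs)"
    have "rotate (l + n) xs = rotate k xs" if "xs \<noteq> []"
    proof (subst (1 2) rotate_conv_mod, rule arg_cong[where f = "\<lambda>i. rotate i xs"])
      have "n mod length xs \<le> length xs" using that by simp
      then have "l + n mod length xs = k + length xs" by (simp add: l_def)
      then show "(l + n) mod length xs = k mod length xs"
        by (metis mod_add_right_eq mod_add_self2)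
    qed
    then have "rotate l (rotate n xs) = rotate k xs"
      by (cases "xs = []") (simp_all add: rotate_rotate)
    then show ?thesis unfolding cyc_def by (metis (mono_tags, lifting) mem_Collect_eq)
  qed
  then show ?thesis unfolding cyc_def by (auto simp: rotate_rotate)
qed

lemma cyc_subst_rotate: "cyc (subst_list (rotate n xs) s) = cyc (subst_list xs s)"
proof (induction n)
  case (Suc n)
  have "cyc (subst_list (rotate1 ys) s) = cyc (subst_list ys s)" for ys
  proof (cases ys)
    case (Cons v vs)
    have "subst_list (rotate1 ys) s = rotate (length (s (unblk v))) (subst_list ys s)"
      by (simp add: Cons subst_list_def rotate_append)
    then show ?thesis by (simp add: cyc_rotate)
  qed simp
  then show ?case using Suc by simp
qed simp

lemma subst_cyc_cyc: "subst_cyc (cyc xs) s = cyc (subst_list xs s)"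
  unfolding subst_cyc_def
  by (subst (2) cyc_def) (auto simp: cyc_subst_rotate)


section \<open>The contractad and the modules\<close>

definition PlanEq_basis :: "('a, 'a vert list) bcontractad" where
  "PlanEq_basis = \<lparr>
     basis = plan_orderings,
     relabel = map,
     bact = (\<lambda>\<Gamma> I. subst_list)\<rparr>"

definition CycPerm_basis :: "('a, 'a vert list set, 'a vert list) bmodule" where
  "CycPerm_basis = \<lparr>
     basis = cyclic_orderings,
     relabel = (\<lambda>f. (`) (map f)),
     bact = (\<lambda>\<Gamma> I. subst_cyc)\<rparr>"

definition CycEq_basis :: "('a, 'a vert list set, 'a vert list) bmodule" where
  "CycEq_basis = CycPerm_basis
     \<lparr>basis := (\<lambda>\<Gamma>. {c \<in> cyclic_orderings \<Gamma>. \<exists>xs\<in>c. xs \<in> plan_orderings \<Gamma>})\<rparr>"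

definition CycHam_basis :: "('a, 'a vert list set) bcollection" where
  "CycHam_basis = \<lparr>
     basis = (\<lambda>\<Gamma>. if card (verts \<Gamma>) = 1 then {} else ham_cycles (complement \<Gamma>)),
     relabel = (\<lambda>f. (`) (map f))\<rparr>"

definition PlanEq :: "('a, 'k::field, 'a vert list \<Rightarrow>\<^sub>0 'k) contractad" where
  "PlanEq = linearize PlanEq_basis"

definition CycPerm ::
  "('a, 'k::field, 'a vert list set \<Rightarrow>\<^sub>0 'k, 'a vert list \<Rightarrow>\<^sub>0 'k) rmodule" where
  "CycPerm = linearize CycPerm_basis"

definition CycEq ::
  "('a, 'k::field, 'a vert list set \<Rightarrow>\<^sub>0 'k, 'a vert list \<Rightarrow>\<^sub>0 'k) rmodule" where
  "CycEq = linearize CycEq_basis"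

definition CycHam_PlanEq ::
  "('a, 'k::field,
    ('a vert set set \<times> 'a vert list set \<times> ('a vert set \<Rightarrow> 'a vert list)) \<Rightarrow>\<^sub>0 'k,
    'a vert list \<Rightarrow>\<^sub>0 'k) rmodule" where
  "CycHam_PlanEq = linearize (composite CycHam_basis PlanEq_basis)"

end

theory Submission
  imports Defs
begin

text \<open>
  Cut a cyclic ordering of the vertices into arcs that are leaf sequences of admissible trees, and
  merge cyclically consecutive arcs as long as an edge joins them.  Either one arc remains, and the
  ordering lies in $\mathsf{CycEq}$, or the final arcs are the blocks of a tube partition \<open>I\<close>, and the
  cyclic ordering of the blocks is a Hamiltonian cycle of the complement of $\Gamma/I$.  The
  result does not depend on the choices: an admissible arc never leaves a block of such a final
  decomposition, since an edge between its two halves would join two consecutive blocks.  So the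
  basis of $\mathsf{CycPerm}$ is the disjoint union of the bases of the two summands, compatibly with
  relabelling and substitution.
\<close>

section \<open>Graphs\<close>

text \<open>The isomorphism is built against the direction of the cutting: on the direct sum it is
  the identity on \<open>CycEq\<close> and \<open>subst_cyc\<close> on the triples
  \<open>(I, c, s)\<close>. These formulas are compatible with relabelling and composition by direct
  computation, whereas a decomposition of a given ordering would first have to be chosen. Existence
  and uniqueness of the decomposition become surjectivity and injectivity on bases, and the linear
  map is inverted only at the end. The obstacle is rotation: an arc may run across the point where a
  cyclic ordering is opened into a list. Adjacency of cyclic neighbours is therefore expressed by
  the last and first entries of representatives, and a representative that starts in a block and
  ends outside it is shown to be opened exactly at the start of that block. Such an opening needs a
  second block. This, and the disjointness of the two summands, is where the convention that the
  one-vertex graph has no Hamiltonian cycle enters.\<close>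

lemma simple_graph_edgeD:
  assumes "simple_graph \<Gamma>" "{u, v} \<in> edges \<Gamma>"
  shows "u \<in> verts \<Gamma>" "v \<in> verts \<Gamma>" "u \<noteq> v"
proof -
  obtain a b where "a \<in> verts \<Gamma>" "b \<in> verts \<Gamma>" "a \<noteq> b" "{u, v} = {a, b}"
    using assms unfolding simple_graph_def by meson
  then show "u \<in> verts \<Gamma>" "v \<in> verts \<Gamma>" "u \<noteq> v" by (auto simp: doubleton_eq_iff)
qed

lemma verts_induced [simp]: "verts (induced \<Gamma> S) = S"
  by (simp add: induced_def)

lemma edges_induced_iff [simp]:
  "{u, v} \<in> edges (induced \<Gamma> S) \<longleftrightarrow> {u, v} \<in> edges \<Gamma> \<and> u \<in> S \<and> v \<in> S"
  by (simp add: induced_def)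

lemma simple_graph_induced:
  assumes "simple_graph \<Gamma>" "S \<subseteq> verts \<Gamma>"
  shows "simple_graph (induced \<Gamma> S)"
  using assms unfolding simple_graph_def induced_def
  by (auto intro: finite_subset) (metis insert_subset)

text \<open>A path from a vertex of \<open>A\<close> to one outside must leave \<open>A\<close>
  along some edge; simplicity keeps the far end of that edge in the vertex set, hence in
  \<open>B\<close>.\<close>

lemma connected_graph_crossing_edge:
  assumes \<Gamma>: "connected_graph \<Gamma>" and V: "verts \<Gamma> = A \<union> B" "A \<inter> B = {}" "A \<noteq> {}" "B \<noteq> {}"
  obtains u v where "u \<in> A" "v \<in> B" "{u, v} \<in> edges \<Gamma>"
proof -
  have simple: "simple_graph \<Gamma>" using \<Gamma> by (simp add: connected_graph_def)
  obtain a b where ab: "a \<in> A" "b \<in> B" using V by blast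
  then have "(a, b) \<in> {(x, y). {x, y} \<in> edges \<Gamma>}\<^sup>*"
    using \<Gamma> V by (simp add: connected_graph_def)
  moreover have "b \<notin> A" using ab V by blast
  ultimately obtain x y where "x \<in> A" "y \<notin> A" "{x, y} \<in> edges \<Gamma>"
    using ab(1) by (induction rule: rtrancl_induct) auto
  then show ?thesis
    using that simple_graph_edgeD(2)[OF simple] V by blast
qed

lemma tube_singleton: "simple_graph \<Gamma> \<Longrightarrow> v \<in> verts \<Gamma> \<Longrightarrow> tube \<Gamma> {v}"
  by (simp add: tube_def connected_graph_def simple_graph_induced)

lemma tube_Un:
  assumes \<Gamma>: "simple_graph \<Gamma>" and tubes: "tube \<Gamma> A" "tube \<Gamma> B"
    and edge: "u \<in> A" "v \<in> B" "{u, v} \<in> edges \<Gamma>"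
  shows "tube \<Gamma> (A \<union> B)"
proof -
  let ?R = "\<lambda>S. {(x, y). {x, y} \<in> edges (induced \<Gamma> S)}"
  have R: "(x, y) \<in> (?R (A \<union> B))\<^sup>*" if "x \<in> S" "y \<in> S" "S = A \<or> S = B" for x y S
  proof -
    have "?R S \<subseteq> ?R (A \<union> B)" using that(3) by auto
    moreover have "(x, y) \<in> (?R S)\<^sup>*"
      using tubes that by (auto simp: tube_def connected_graph_def)
    ultimately show ?thesis by (meson rtrancl_mono subsetD)
  qed
  have uv: "(u, v) \<in> (?R (A \<union> B))\<^sup>*" "(v, u) \<in> (?R (A \<union> B))\<^sup>*"
    using edge by (auto simp: insert_commute)
  have u: "(x, u) \<in> (?R (A \<union> B))\<^sup>* \<and> (u, x) \<in> (?R (A \<union> B))\<^sup>*" if "x \<in> A \<union> B" for x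
  proof (cases "x \<in> A")
    case True
    with edge(1) show ?thesis by (intro conjI R[where S = A]) simp_all
  next
    case False
    with that have "(x, v) \<in> (?R (A \<union> B))\<^sup>*" "(v, x) \<in> (?R (A \<union> B))\<^sup>*"
      using R[of x B v] R[of v B x] edge(2) by blast+
    with uv show ?thesis by (blast intro: rtrancl_trans)
  qed
  have "\<forall>x\<in>A \<union> B. \<forall>y\<in>A \<union> B. (x, y) \<in> (?R (A \<union> B))\<^sup>*"
  proof (intro ballI)
    fix x y assume "x \<in> A \<union> B" "y \<in> A \<union> B"
    then have "(x, u) \<in> (?R (A \<union> B))\<^sup>*" "(u, y) \<in> (?R (A \<union> B))\<^sup>*" using u by simp_all
    then show "(x, y) \<in> (?R (A \<union> B))\<^sup>*" by (rule rtrancl_trans)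
  qed
  moreover have "A \<union> B \<subseteq> verts \<Gamma>" "A \<union> B \<noteq> {}"
    using tubes by (auto simp: tube_def)
  ultimately show ?thesis
    using simple_graph_induced[OF \<Gamma>, of "A \<union> B"] by (simp add: tube_def connected_graph_def)
qed


section \<open>Orderings by admissible trees\<close>

text \<open>Leaf sequences of admissible trees without the trees: instead of a tube below each node,
  an edge joins the leaves on its left to those on its right. Only an edge set occurs, which makes
  it easy to pass between \<Gamma>, its induced subgraphs and its contractions.\<close>

inductive plan_list :: "'v set set \<Rightarrow> 'v list \<Rightarrow> bool" for E where
  single: "plan_list E [v]"
| append: "\<lbrakk>plan_list E xs; plan_list E ys; u \<in> set xs; v \<in> set ys; {u, v} \<in> E\<rbrakk>
    \<Longrightarrow> plan_list E (xs @ ys)"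

lemma plan_list_nonempty: "plan_list E xs \<Longrightarrow> xs \<noteq> []"
  by (induction rule: plan_list.induct) auto

lemma plan_list_map:
  assumes "plan_list E xs"
    and "\<And>u v. \<lbrakk>u \<in> set xs; v \<in> set xs; {u, v} \<in> E\<rbrakk> \<Longrightarrow> {f u, f v} \<in> E'"
  shows "plan_list E' (map f xs)"
  using assms
proof (induction rule: plan_list.induct)
  case (append xs ys u v)
  then have "plan_list E' (map f xs)" "plan_list E' (map f ys)" "{f u, f v} \<in> E'" by simp_all
  then show ?case using append.hyps by (auto intro: plan_list.append[where u = "f u" and v = "f v"])
qed (simp add: plan_list.single)

lemma plan_list_tube:
  assumes "simple_graph \<Gamma>" "plan_list (edges \<Gamma>) xs" "set xs \<subseteq> verts \<Gamma>"
  shows "tube \<Gamma> (set xs)"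
  using assms(2,3)
  by (induction rule: plan_list.induct) (auto intro: tube_singleton tube_Un assms(1))

lemma plan_list_tree:
  assumes "simple_graph \<Gamma>" "plan_list (edges \<Gamma>) xs" "set xs \<subseteq> verts \<Gamma>"
  shows "\<exists>t. leaves t = xs \<and> subtree_tubes \<Gamma> t"
  using assms(2,3)
proof (induction rule: plan_list.induct)
  case (single v)
  then show ?case by (intro exI[of _ "Leaf v"]) (simp add: tube_singleton assms(1))
next
  case (append xs ys u v)
  then obtain l r where "leaves l = xs" "subtree_tubes \<Gamma> l" "leaves r = ys" "subtree_tubes \<Gamma> r"
    by auto
  moreover have "tube \<Gamma> (set (xs @ ys))"
    using append by (intro plan_list_tube assms(1) plan_list.append)
  ultimately show ?case by (intro exI[of _ "Node l r"]) simp
qed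

lemma leaves_nonempty: "leaves t \<noteq> []"
  by (induction t) auto

text \<open>The connected graph below a node must contain an edge between the leaves of its two
  subtrees. Distinctness makes these two leaf sets disjoint, as
  \<open>connected_graph_crossing_edge\<close> requires.\<close>

lemma subtree_tubes_plan_list:
  "subtree_tubes \<Gamma> t \<Longrightarrow> distinct (leaves t) \<Longrightarrow> plan_list (edges \<Gamma>) (leaves t)"
proof (induction t)
  case (Node l r)
  let ?V = "set (leaves l) \<union> set (leaves r)"
  have "connected_graph (induced \<Gamma> ?V)" using Node.prems(1) by (simp add: tube_def)
  moreover have "set (leaves l) \<inter> set (leaves r) = {}" using Node.prems(2) by simp
  ultimately obtain u v where "u \<in> set (leaves l)" "v \<in> set (leaves r)"
    "{u, v} \<in> edges (induced \<Gamma> ?V)"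
    by (auto simp: leaves_nonempty
        elim: connected_graph_crossing_edge[where A = "set (leaves l)" and B = "set (leaves r)"])
  then show ?case using Node by (auto intro: plan_list.append)
qed (simp add: plan_list.single)

lemma plan_orderings_iff:
  assumes "simple_graph \<Gamma>"
  shows "xs \<in> plan_orderings \<Gamma> \<longleftrightarrow> xs \<in> orderings \<Gamma> \<and> plan_list (edges \<Gamma>) xs"
  using plan_list_tree[OF assms, of xs] subtree_tubes_plan_list[of \<Gamma>]
  unfolding plan_orderings_def admissible_tree_def orderings_def by auto

text \<open>Edges between vertices of \<open>G\<close> are the same in \<Gamma> and in the induced
  graph, so \<open>plan_list_map\<close> with the identity transfers the sequence both ways.\<close>

lemma plan_orderings_induced_iff:
  assumes "simple_graph \<Gamma>" "G \<subseteq> verts \<Gamma>"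
  shows "xs \<in> plan_orderings (induced \<Gamma> G) \<longleftrightarrow>
    distinct xs \<and> set xs = G \<and> plan_list (edges \<Gamma>) xs"
  unfolding plan_orderings_iff[OF simple_graph_induced[OF assms]] orderings_def
  using plan_list_map[of "edges (induced \<Gamma> G)" xs "\<lambda>x. x" "edges \<Gamma>"]
    plan_list_map[of "edges \<Gamma>" xs "\<lambda>x. x" "edges (induced \<Gamma> G)"]
  by auto

lemma set_subst_list: "set (subst_list xs s) = (\<Union>v\<in>set xs. set (s (unblk v)))"
  by (simp add: subst_list_def)

lemma subst_list_append: "subst_list (xs @ ys) s = subst_list xs s @ subst_list ys s"
  by (simp add: subst_list_def)

lemma subst_list_cong:
  "(\<And>v. v \<in> set xs \<Longrightarrow> s (unblk v) = t (unblk v)) \<Longrightarrow> subst_list xs s = subst_list xs t"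
  unfolding subst_list_def by (metis map_ext)

text \<open>Induction along the construction of \<open>xs\<close>: where two parts are joined by an
  edge of \<open>E\<close>, the last assumption lifts it to an edge of \<open>E'\<close> between the
  substituted words.\<close>

lemma plan_list_subst_list:
  assumes "plan_list E xs"
    and "\<And>v. v \<in> set xs \<Longrightarrow> plan_list E' (s (unblk v))"
    and "\<And>u v. \<lbrakk>u \<in> set xs; v \<in> set xs; {u, v} \<in> E\<rbrakk>
      \<Longrightarrow> \<exists>a\<in>set (s (unblk u)). \<exists>b\<in>set (s (unblk v)). {a, b} \<in> E'"
  shows "plan_list E' (subst_list xs s)"
  using assms
proof (induction rule: plan_list.induct)
  case (single v)
  then show ?case by (simp add: subst_list_def)
next
  case (append xs ys u v)
  then have "plan_list E' (subst_list xs s)" "plan_list E' (subst_list ys s)" by simp_all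
  moreover obtain a b where "a \<in> set (s (unblk u))" "b \<in> set (s (unblk v))" "{a, b} \<in> E'"
    using append.prems(2)[of u v] append.hyps by auto
  ultimately show ?case
    unfolding subst_list_append using append.hyps
    by (intro plan_list.append[where u = a and v = b]) (auto simp: set_subst_list)
qed


section \<open>Contractions\<close>

lemma unblk_blk: "finite G \<Longrightarrow> unblk (blk G) = G"
  by (simp add: blk_def Abs_fset_inverse)

lemma verts_contract: "verts (contract \<Gamma> I) = blk ` I"
  by (simp add: contract_def)

text \<open>Blocks are arbitrary nonempty vertex sets here. A block that carries an admissible
  ordering is a tube by \<open>plan_list_tube\<close>, so tubes are recovered from \<open>s\<close>
  wherever a basis element \<open>(I, c, s)\<close> is given.\<close>

locale graph_partition =
  fixes \<Gamma> :: "'a vgraph" and I :: "'a vert set set"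
  assumes simple: "simple_graph \<Gamma>" and part: "partition_on (verts \<Gamma>) I"
begin

lemma finite_partition: "finite I"
  using finite_elements[OF _ part] simple by (simp add: simple_graph_def)

lemma finite_block: "G \<in> I \<Longrightarrow> finite G"
  using partition_onD1[OF part] simple by (auto simp: simple_graph_def intro: finite_subset)

lemma block_nonempty: "G \<in> I \<Longrightarrow> G \<noteq> {}"
  using partition_onD3[OF part] by blast

lemma block_unique: "\<lbrakk>G \<in> I; H \<in> I; x \<in> G; x \<in> H\<rbrakk> \<Longrightarrow> G = H"
  using partition_onD2[OF part] by (auto simp: disjoint_def)

lemma block_subset: "G \<in> I \<Longrightarrow> G \<subseteq> verts \<Gamma>"
  using partition_onD1[OF part] by blast

lemma unblk_blk_block [simp]: "G \<in> I \<Longrightarrow> unblk (blk G) = G"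
  by (rule unblk_blk[OF finite_block])

lemma blk_eq_iff [simp]: "G \<in> I \<Longrightarrow> H \<in> I \<Longrightarrow> blk G = blk H \<longleftrightarrow> G = H"
  by (metis unblk_blk_block)

lemma inj_on_blk: "inj_on blk I"
  by (rule inj_onI) simp

lemma edges_contract_iff:
  assumes "G \<in> I" "H \<in> I"
  shows "{blk G, blk H} \<in> edges (contract \<Gamma> I) \<longleftrightarrow>
    G \<noteq> H \<and> (\<exists>u\<in>G. \<exists>v\<in>H. {u, v} \<in> edges \<Gamma>)"
proof
  assume "{blk G, blk H} \<in> edges (contract \<Gamma> I)"
  then obtain G' H' where *: "G' \<in> I" "H' \<in> I" "G' \<noteq> H'" "{blk G, blk H} = {blk G', blk H'}"
    "\<exists>u\<in>G'. \<exists>v\<in>H'. {u, v} \<in> edges \<Gamma>"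
    unfolding contract_def by auto
  then have "G' = G \<and> H' = H \<or> G' = H \<and> H' = G"
    using assms by (auto simp: doubleton_eq_iff)
  then show "G \<noteq> H \<and> (\<exists>u\<in>G. \<exists>v\<in>H. {u, v} \<in> edges \<Gamma>)"
    using *(3,5) by (metis insert_commute)
qed (use assms in \<open>auto simp: contract_def\<close>)

lemma simple_graph_contract: "simple_graph (contract \<Gamma> I)"
  unfolding simple_graph_def verts_contract
proof (intro conjI ballI)
  fix e assume "e \<in> edges (contract \<Gamma> I)"
  then obtain G H where "G \<in> I" "H \<in> I" "G \<noteq> H" "e = {blk G, blk H}"
    by (auto simp: contract_def)
  then show "\<exists>u\<in>blk ` I. \<exists>v\<in>blk ` I. u \<noteq> v \<and> e = {u, v}"
    by (metis blk_eq_iff imageI)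
qed (simp add: finite_partition)

lemma card_verts_contract: "card (verts (contract \<Gamma> I)) = card I"
  by (simp add: verts_contract card_image inj_on_blk)

lemma mem_flatten_iff:
  assumes "C \<subseteq> blk ` I" "G \<in> I" "x \<in> G"
  shows "x \<in> flatten C \<longleftrightarrow> blk G \<in> C"
  proof
  assume "x \<in> flatten C"
  then obtain H where "H \<in> I" "blk H \<in> C" "x \<in> H" using assms(1) by (auto simp: flatten_def)
  then show "blk G \<in> C" using block_unique[OF assms(2)] assms(3) by blast
qed (use assms in \<open>force simp: flatten_def\<close>)

lemma flatten_verts_contract: "flatten (verts (contract \<Gamma> I)) = verts \<Gamma>"
  using partition_onD1[OF part] by (auto simp: flatten_def verts_contract)

lemma subst_list_blocks:
  assumes C: "C \<subseteq> blk ` I" and xs: "distinct xs" "set xs = C"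
    and p: "\<And>G. G \<in> I \<Longrightarrow> distinct (p G) \<and> set (p G) = G"
  shows "distinct (subst_list xs p)" "set (subst_list xs p) = flatten C"
proof -
  show "set (subst_list xs p) = flatten C"
    unfolding set_subst_list flatten_def xs(2) using C p by (intro SUP_cong) auto
  have "distinct (subst_list xs p)" if "set xs \<subseteq> blk ` I" using xs(1) that
  proof (induction xs)
    case (Cons v xs)
    then obtain G where G: "G \<in> I" "v = blk G" by auto
    have "set (p G) \<inter> set (subst_list xs p) = {}"
    proof (rule ccontr)
      assume "set (p G) \<inter> set (subst_list xs p) \<noteq> {}"
      then obtain x w where x: "x \<in> G" "w \<in> set xs" "x \<in> set (p (unblk w))"
        using p G by (auto simp: set_subst_list)
      moreover obtain H where "H \<in> I" "w = blk H" using x Cons.prems by auto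
      ultimately show False using block_unique G p Cons.prems by auto
    qed
    then show ?case using Cons G p by (simp add: subst_list_def)
  qed (simp add: subst_list_def)
  then show "distinct (subst_list xs p)" using xs C by simp
qed

lemma plan_list_subst_list_blocks:
  assumes xs: "set xs \<subseteq> blk ` I" "plan_list (edges (contract \<Gamma> I)) xs"
    and p: "\<And>G. G \<in> I \<Longrightarrow> set (p G) = G \<and> plan_list (edges \<Gamma>) (p G)"
  shows "plan_list (edges \<Gamma>) (subst_list xs p)"
  using xs(2)
proof (rule plan_list_subst_list)
  fix v assume "v \<in> set xs"
  then show "plan_list (edges \<Gamma>) (p (unblk v))" using xs p by auto
next
  fix u v assume uv: "u \<in> set xs" "v \<in> set xs" and edge: "{u, v} \<in> edges (contract \<Gamma> I)"
  then obtain G H where "G \<in> I" "H \<in> I" "u = blk G" "v = blk H" using xs(1) by blast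
  then show "\<exists>a\<in>set (p (unblk u)). \<exists>b\<in>set (p (unblk v)). {a, b} \<in> edges \<Gamma>"
    using edge p edges_contract_iff by auto
qed

lemma subst_list_ordering:
  assumes "xs \<in> orderings (contract \<Gamma> I)" "\<And>G. G \<in> I \<Longrightarrow> distinct (p G) \<and> set (p G) = G"
  shows "subst_list xs p \<in> orderings \<Gamma>"
  using assms subst_list_blocks[of "blk ` I" xs p] flatten_verts_contract
  by (auto simp: orderings_def verts_contract)

end

lemma graph_partition_of_tubes:
  "connected_graph \<Gamma> \<Longrightarrow> tube_partition \<Gamma> I \<Longrightarrow> graph_partition \<Gamma> I"
  by (simp add: graph_partition_def connected_graph_def tube_partition_def)

text \<open>A path in \<Gamma> projects to the contraction: an edge inside a block collapses, any
  other becomes an edge between two blocks. Module maps are controlled only on connected graphs, and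
  compatibility with the action evaluates them at \<open>contract \<Gamma> I\<close>.\<close>

lemma connected_contract:
  assumes \<Gamma>: "connected_graph \<Gamma>" and I: "tube_partition \<Gamma> I"
  shows "connected_graph (contract \<Gamma> I)"
proof -
  interpret graph_partition \<Gamma> I by (rule graph_partition_of_tubes[OF assms])
  let ?R = "{(x, y). {x, y} \<in> edges (contract \<Gamma> I)}"
  have *: "\<forall>H\<in>I. v \<in> H \<longrightarrow> (blk G, blk H) \<in> ?R\<^sup>*"
    if "(u, v) \<in> {(x, y). {x, y} \<in> edges \<Gamma>}\<^sup>*" "G \<in> I" "u \<in> G" for u v G
    using that(1)
  proof (induction rule: rtrancl_induct)
    case base
    then show ?case using that block_unique by blast
  next
    case (step v w)
    have e: "{v, w} \<in> edges \<Gamma>" using step.hyps(2) by simp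
    then have "v \<in> \<Union>I" using simple_graph_edgeD(1)[OF simple] partition_onD1[OF part] by metis
    then obtain H where H: "H \<in> I" "v \<in> H" by blast
    then have GH: "(blk G, blk H) \<in> ?R\<^sup>*" using step.IH by simp
    show ?case
    proof (intro ballI impI)
      fix H' assume H': "H' \<in> I" "w \<in> H'"
      show "(blk G, blk H') \<in> ?R\<^sup>*"
      proof (cases "H = H'")
        case False
        then have "(blk H, blk H') \<in> ?R"
          using edges_contract_iff[OF H(1) H'(1)] e H(2) H'(2) by auto
        with GH show ?thesis by (rule rtrancl.rtrancl_into_rtrancl)
      qed (use GH in simp)
    qed
  qed
  have "(blk G, blk H) \<in> ?R\<^sup>*" if GH: "G \<in> I" "H \<in> I" for G H
  proof -
    obtain u v where uv: "u \<in> G" "v \<in> H" using GH block_nonempty by blast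
    then have "u \<in> verts \<Gamma>" "v \<in> verts \<Gamma>" using GH block_subset by blast+
    then have "(u, v) \<in> {(x, y). {x, y} \<in> edges \<Gamma>}\<^sup>*"
      using \<Gamma> by (simp add: connected_graph_def)
    from *[OF this GH(1) uv(1)] GH(2) uv(2) show ?thesis by blast
  qed
  moreover have "I \<noteq> {}" using \<Gamma> partition_onD1[OF part] by (auto simp: connected_graph_def)
  ultimately show ?thesis
    using simple_graph_contract by (auto simp: connected_graph_def verts_contract)
qed

text \<open>Common source of two isomorphisms: for relabelling along a graph isomorphism,
  \<open>h\<close> is the image map on blocks; for comparing an iterated contraction with a single
  one, \<open>h\<close> is \<open>flatten\<close>.\<close>

lemma graph_iso_on_blocks:
  assumes "graph_partition \<Gamma> I" "graph_partition \<Delta> J" and h: "bij_betw h I J"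
    and adj: "\<And>G H. \<lbrakk>G \<in> I; H \<in> I; G \<noteq> H\<rbrakk> \<Longrightarrow> (\<exists>u\<in>G. \<exists>v\<in>H. {u, v} \<in> edges \<Gamma>) \<longleftrightarrow>
      (\<exists>u\<in>h G. \<exists>v\<in>h H. {u, v} \<in> edges \<Delta>)"
  shows "graph_iso (on_blocks h) (contract \<Gamma> I) (contract \<Delta> J)"
proof -
  interpret I: graph_partition \<Gamma> I by fact
  interpret J: graph_partition \<Delta> J by fact
  have on: "on_blocks h (blk G) = blk (h G)" if "G \<in> I" for G
    using that by (simp add: on_blocks_def)
  have hJ: "h G \<in> J" if "G \<in> I" for G using h that by (auto simp: bij_betw_def)
  have heq: "h G = h H \<longleftrightarrow> G = H" if "G \<in> I" "H \<in> I" for G H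
    using h that by (auto simp: bij_betw_def inj_on_def)
  have "bij_betw (on_blocks h) (blk ` I) (blk ` J)"
  proof (rule bij_betw_imageI)
    show "inj_on (on_blocks h) (blk ` I)" by (auto simp: inj_on_def on hJ heq)
    have "on_blocks h ` blk ` I = blk ` h ` I" by (auto simp: image_image on)
    then show "on_blocks h ` blk ` I = blk ` J" using h by (simp add: bij_betw_def)
  qed
  moreover have "{blk G, blk H} \<in> edges (contract \<Gamma> I) \<longleftrightarrow>
      {blk (h G), blk (h H)} \<in> edges (contract \<Delta> J)" if GH: "G \<in> I" "H \<in> I" for G H
    unfolding I.edges_contract_iff[OF GH] J.edges_contract_iff[OF GH[THEN hJ]] heq[OF GH]
    using adj[OF GH] by blast
  ultimately show ?thesis
    by (simp add: graph_iso_def verts_contract on)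
qed


section \<open>Cyclic orderings\<close>

lemma mem_cyc_iff: "ys \<in> cyc xs \<longleftrightarrow> (\<exists>as bs. xs = as @ bs \<and> ys = bs @ as)"
proof
  assume "ys \<in> cyc xs"
  then obtain n where n: "ys = rotate n xs" by (auto simp: cyc_def)
  let ?k = "n mod length xs"
  show "\<exists>as bs. xs = as @ bs \<and> ys = bs @ as"
    by (rule exI[of _ "take ?k xs"], rule exI[of _ "drop ?k xs"]) (simp add: n rotate_drop_take)
next
  assume "\<exists>as bs. xs = as @ bs \<and> ys = bs @ as"
  then show "ys \<in> cyc xs" unfolding cyc_def by (metis (mono_tags, lifting) mem_Collect_eq rotate_append)
qed

lemma cyc_self: "xs \<in> cyc xs"
  unfolding mem_cyc_iff by (rule exI[of _ xs], rule exI[of _ "[]"]) simp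

lemma cyc_eqI: "ys \<in> cyc xs \<Longrightarrow> cyc ys = cyc xs"
proof -
  assume "ys \<in> cyc xs"
  then obtain n where "ys = rotate n xs" unfolding cyc_def by blast
  then show ?thesis by (simp add: cyc_rotate)
qed

lemma cyc_append: "cyc (ys @ xs) = cyc (xs @ ys)"
proof (rule cyc_eqI)
  show "ys @ xs \<in> cyc (xs @ ys)"
    unfolding mem_cyc_iff by (intro exI[of _ xs] exI[of _ ys]) simp
qed

lemma map_cyc: "map f ` cyc xs = cyc (map f xs)"
  by (simp add: cyc_def full_SetCompr_eq image_image rotate_map)

lemma set_cyc: "ys \<in> cyc xs \<Longrightarrow> set ys = set xs"
  unfolding cyc_def by auto

lemma cyc_ordering:
  "ys \<in> cyc xs \<Longrightarrow> xs \<in> orderings \<Gamma> \<Longrightarrow> ys \<in> orderings \<Gamma>"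
  unfolding cyc_def orderings_def by (elim CollectE exE conjE) simp

lemma cyclic_orderings_cases:
  assumes "c \<in> cyclic_orderings \<Gamma>"
  obtains xs where "xs \<in> orderings \<Gamma>" "c = cyc xs"
  using assms unfolding cyclic_orderings_def by blast

text \<open>Each cyclically consecutive pair is the last and first entry of some rotation. In this
  form the condition visibly depends on the cyclic ordering alone; nonemptiness makes
  \<open>hd\<close> and \<open>last\<close> genuine entries.\<close>

lemma ham_cycles_iff:
  assumes "verts \<Gamma> \<noteq> {}"
  shows "c \<in> ham_cycles \<Gamma> \<longleftrightarrow>
    c \<in> cyclic_orderings \<Gamma> \<and> (\<forall>ys\<in>c. {last ys, hd ys} \<in> edges \<Gamma>)"
proof -
  have "(\<forall>i<length xs. {xs ! i, xs ! (Suc i mod length xs)} \<in> edges \<Gamma>) \<longleftrightarrow>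
      (\<forall>ys\<in>cyc xs. {last ys, hd ys} \<in> edges \<Gamma>)" if "xs \<in> orderings \<Gamma>" for xs
  proof -
    let ?n = "length xs"
    have n: "?n > 0" using assms that by (auto simp: orderings_def)
    have hd: "hd (rotate k xs) = xs ! (k mod ?n)" for k
      using n by (simp add: hd_rotate_conv_nth)
    have last: "last (rotate k xs) = xs ! ((k + (?n - 1)) mod ?n)" for k
      using n nth_rotate[of "?n - 1" xs k] by (simp add: last_conv_nth)
    show ?thesis
    proof (intro iffI ballI allI impI)
      fix ys assume *: "\<forall>i<?n. {xs ! i, xs ! (Suc i mod ?n)} \<in> edges \<Gamma>" and "ys \<in> cyc xs"
      then obtain k where k: "ys = rotate k xs" by (auto simp: cyc_def)
      \<comment> \<open>The seam of \<open>rotate k xs\<close> lies between positions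
        \<open>k - 1\<close> and \<open>k\<close> modulo the length; adding \<open>?n - 1\<close>
        avoids a truncated subtraction at \<open>k = 0\<close>.\<close>
      let ?i = "(k + (?n - 1)) mod ?n"
      have "Suc (k + (?n - 1)) = k + ?n" using n by simp
      then have "Suc ?i mod ?n = k mod ?n" by (metis mod_Suc_eq mod_add_self2)
      then show "{last ys, hd ys} \<in> edges \<Gamma>"
        using *[rule_format, of ?i] n unfolding k hd last by (metis mod_less_divisor)
    next
      fix i assume *: "\<forall>ys\<in>cyc xs. {last ys, hd ys} \<in> edges \<Gamma>" and i: "i < ?n"
      have "rotate (Suc i) xs \<in> cyc xs" unfolding cyc_def by blast
      moreover have "Suc i + (?n - 1) = i + ?n" using i by simp
      then have "(Suc i + (?n - 1)) mod ?n = i" using i by (simp only: mod_add_self2 mod_less)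
      ultimately show "{xs ! i, xs ! (Suc i mod ?n)} \<in> edges \<Gamma>"
        using * by (metis hd last)
    qed
  qed
  then show ?thesis unfolding ham_cycles_def cyclic_orderings_def by blast
qed

text \<open>An edge of the complement needs two different ends, which the seam of a representative
  has as soon as there are two vertices. On one vertex the nonadjacency condition holds by itself,
  so the cardinality clause is what expresses the convention.\<close>

lemma basis_CycHam_iff:
  assumes "simple_graph \<Gamma>" "verts \<Gamma> \<noteq> {}"
  shows "c \<in> basis CycHam_basis \<Gamma> \<longleftrightarrow> card (verts \<Gamma>) \<noteq> 1 \<and> c \<in> cyclic_orderings \<Gamma> \<and>
    (\<forall>ys\<in>c. {last ys, hd ys} \<notin> edges \<Gamma>)"
proof (cases "card (verts \<Gamma>) = 1")
  case False
  have verts: "verts (complement \<Gamma>) = verts \<Gamma>" by (simp add: complement_def)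
  then have co: "cyclic_orderings (complement \<Gamma>) = cyclic_orderings \<Gamma>"
    by (simp add: cyclic_orderings_def orderings_def)
  have "{last ys, hd ys} \<in> edges (complement \<Gamma>) \<longleftrightarrow> {last ys, hd ys} \<notin> edges \<Gamma>"
    if "c \<in> cyclic_orderings \<Gamma>" "ys \<in> c" for ys
  proof -
    have ys: "distinct ys" "set ys = verts \<Gamma>"
      using that cyc_ordering by (auto simp: cyclic_orderings_def orderings_def)
    then have "length ys \<noteq> 1" "ys \<noteq> []" using False distinct_card[OF ys(1)] assms(2) by auto
    then obtain y zs z where "ys = y # zs @ [z]"
      by (metis One_nat_def append_butlast_last_id length_Cons list.exhaust list.size(3))
    then have "last ys \<noteq> hd ys" "last ys \<in> verts \<Gamma>" "hd ys \<in> verts \<Gamma>" using ys by auto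
    then show ?thesis by (auto simp: complement_def doubleton_eq_iff insert_commute)
  qed
  then show ?thesis
    using False assms(2) by (auto simp: CycHam_basis_def ham_cycles_iff verts co)
qed (simp add: CycHam_basis_def)

lemma basis_CycHam_relabel:
  assumes "simple_graph \<Gamma>" "verts \<Gamma> \<noteq> {}" "simple_graph \<Delta>" and f: "graph_iso f \<Gamma> \<Delta>"
    and c: "c \<in> basis CycHam_basis \<Gamma>"
  shows "map f ` c \<in> basis CycHam_basis \<Delta>"
proof -
  have bij: "bij_betw f (verts \<Gamma>) (verts \<Delta>)" using f by (simp add: graph_iso_def)
  then have \<Delta>: "verts \<Delta> \<noteq> {}" "card (verts \<Delta>) = card (verts \<Gamma>)"
    using assms(2) bij_betw_same_card[OF bij] by (auto simp: bij_betw_def)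
  have c': "card (verts \<Gamma>) \<noteq> 1" "c \<in> cyclic_orderings \<Gamma>" "\<forall>ys\<in>c. {last ys, hd ys} \<notin> edges \<Gamma>"
    using c basis_CycHam_iff assms(1,2) by blast+
  obtain xs where xs: "xs \<in> orderings \<Gamma>" "c = cyc xs" by (rule cyclic_orderings_cases[OF c'(2)])
  have "map f xs \<in> orderings \<Delta>"
    using xs(1) bij by (auto simp: orderings_def bij_betw_def distinct_map)
  then have "map f ` c \<in> cyclic_orderings \<Delta>" by (auto simp: cyclic_orderings_def xs(2) map_cyc)
  moreover have "{last (map f ys), hd (map f ys)} \<notin> edges \<Delta>" if "ys \<in> c" for ys
  proof -
    have "ys \<in> orderings \<Gamma>" using cyc_ordering xs that by blast
    then have "ys \<noteq> []" "set ys = verts \<Gamma>" using assms(2) by (auto simp: orderings_def)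
    moreover have "last ys \<in> set ys" "hd ys \<in> set ys" using calculation(1) by simp_all
    ultimately have "{last ys, hd ys} \<in> edges \<Gamma> \<longleftrightarrow> {f (last ys), f (hd ys)} \<in> edges \<Delta>"
      using f by (simp add: graph_iso_def)
    then show ?thesis using c'(3) that \<open>ys \<noteq> []\<close> by (simp add: hd_map last_map)
  qed
  ultimately show ?thesis using basis_CycHam_iff[OF assms(3) \<Delta>(1)] c'(1) \<Delta>(2) by auto
qed


section \<open>Decompositions of cyclic orderings\<close>

text \<open>Read cyclically, \<open>ps @ qs\<close> passes from outside \<open>P\<close> into
  \<open>P\<close> only at the beginning of \<open>ps\<close>, so a rotation whose seam is such a
  passage is trivial.\<close>

lemma cyc_unique_start:
  assumes "ys \<in> cyc (ps @ qs)" "\<forall>x\<in>set ps. P x" "\<forall>x\<in>set qs. \<not> P x"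
    and "ys \<noteq> []" "P (hd ys)" "\<not> P (last ys)"
  shows "ys = ps @ qs"
proof -
  obtain as bs where *: "ps @ qs = as @ bs" "ys = bs @ as"
    using assms(1) unfolding mem_cyc_iff by blast
  show ?thesis
  proof (cases "as = [] \<or> bs = []")
    case False
    \<comment> \<open>For a proper cut, failure of \<open>P\<close> at \<open>last as\<close> means
      that \<open>as\<close> reaches into \<open>qs\<close>; then \<open>bs\<close> lies in
      \<open>qs\<close>, against \<open>P (hd bs)\<close>.\<close>
    then have "P (hd bs)" "\<not> P (last as)" using assms(5,6) *(2) by simp_all
    moreover have "hd bs \<in> set bs" "last as \<in> set as" using False by auto
    ultimately have False using *(1) assms(2,3) False
      by (auto simp: append_eq_append_conv2)
    then show ?thesis ..
  next
    case True
    with * show ?thesis by (elim disjE) simp_all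
  qed
qed

section \<open>Cutting cyclic orderings at block boundaries\<close>

context graph_partition
begin

text \<open>Membership of each \<open>s G\<close> in \<open>plan_orderings\<close> of the induced
  graph, expressed by the edges of \<Gamma> so that the induced graph disappears; extensionality of
  \<open>s\<close> is kept apart.\<close>

definition block_orderings :: "('a vert set \<Rightarrow> 'a vert list) \<Rightarrow> bool" where
  "block_orderings s \<longleftrightarrow> (\<forall>G\<in>I. distinct (s G) \<and> set (s G) = G \<and> plan_list (edges \<Gamma>) (s G))"

lemma block_orderingsD:
  assumes "block_orderings s" "G \<in> I"
  shows "distinct (s G)" "set (s G) = G" "plan_list (edges \<Gamma>) (s G)"
  using assms by (auto simp: block_orderings_def)

text \<open>The word \<open>s G\<close> is one arc of the cyclic ordering and no other word meets
  \<open>G\<close>, so a seam that enters \<open>G\<close> from outside lies at the start of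
  \<open>s G\<close>. This recovers a list of blocks from a list of vertices.\<close>

lemma subst_list_start:
  assumes zs: "zs \<in> orderings (contract \<Gamma> I)" and s: "block_orderings s"
    and ys: "ys \<in> cyc (subst_list zs s)" "ys \<noteq> []" and G: "G \<in> I" "hd ys \<in> G" "last ys \<notin> G"
  obtains zs' where "zs' \<in> cyc zs" "zs' \<noteq> []" "hd zs' = blk G" "ys = subst_list zs' s"
proof -
  have "blk G \<in> set zs" using zs G(1) by (simp add: orderings_def verts_contract)
  then obtain as bs where as: "zs = as @ blk G # bs" by (meson split_list)
  let ?zs = "blk G # bs @ as"
  have cyc: "?zs \<in> cyc zs"
    unfolding mem_cyc_iff as by (intro exI[of _ as] exI[of _ "blk G # bs"]) simp
  then obtain n where "?zs = rotate n zs" by (auto simp: cyc_def)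
  then have "cyc (subst_list ?zs s) = cyc (subst_list zs s)" by (metis cyc_subst_rotate)
  moreover have "subst_list ?zs s = s G @ subst_list (bs @ as) s"
    using G by (simp add: subst_list_def)
  ultimately have "ys \<in> cyc (s G @ subst_list (bs @ as) s)" using ys by simp
  then have "ys = s G @ subst_list (bs @ as) s"
  proof (rule cyc_unique_start[where P = "\<lambda>x. x \<in> G"])
    show "\<forall>x\<in>set (s G). x \<in> G" using block_orderingsD(2)[OF s G(1)] by simp
    show "\<forall>x\<in>set (subst_list (bs @ as) s). x \<notin> G"
    proof (intro ballI notI)
      fix x assume "x \<in> set (subst_list (bs @ as) s)" "x \<in> G"
      then obtain v where v: "v \<in> set (bs @ as)" "x \<in> set (s (unblk v))"
        by (auto simp: set_subst_list)
      have "v \<in> set zs" using v(1) as by auto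
      then have "v \<in> blk ` I" "v \<noteq> blk G"
        using zs v(1) by (auto simp: orderings_def verts_contract as)
      then obtain H where H: "H \<in> I" "v = blk H" "v \<noteq> blk G" by blast
      then have "x \<in> H" using v(2) block_orderingsD(2)[OF s H(1)] by simp
      then show False using block_unique \<open>x \<in> G\<close> G(1) H by blast
    qed
  qed (use ys G in auto)
  then show ?thesis using that cyc G by (simp add: subst_list_def)
qed

lemma last_subst_list:
  assumes "zs \<noteq> []" "set zs \<subseteq> blk ` I" "block_orderings s"
  shows "last (subst_list zs s) \<in> unblk (last zs)"
proof -
  have zs: "subst_list zs s = subst_list (butlast zs) s @ s (unblk (last zs))"
    by (subst append_butlast_last_id[OF assms(1), symmetric], subst subst_list_append)
      (simp add: subst_list_def)
  have "last zs \<in> blk ` I" using assms(1,2) last_in_set by blast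
  then obtain G where G: "G \<in> I" "last zs = blk G" by blast
  then have "s G \<noteq> []" "set (s G) = G"
    using block_orderingsD[OF assms(3) G(1)] plan_list_nonempty by blast+
  then show ?thesis using G last_in_set[of "s G"] by (simp add: zs)
qed

text \<open>An edge that joins two consecutive arcs in different blocks would join two cyclically
  consecutive blocks.\<close>

lemma arc_in_block:
  assumes zs: "zs \<in> orderings (contract \<Gamma> I)" and s: "block_orderings s"
    and ham: "\<forall>ys\<in>cyc zs. {last ys, hd ys} \<notin> edges (contract \<Gamma> I)"
    and "plan_list (edges \<Gamma>) xs" "xs @ rest \<in> cyc (subst_list zs s)"
  shows "\<exists>G\<in>I. set xs \<subseteq> G"
  using assms(4,5)
proof (induction xs arbitrary: rest rule: plan_list.induct)
  case (single v)
  then have "v \<in> set (subst_list zs s)" using set_cyc by fastforce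
  then have "v \<in> verts \<Gamma>"
    using subst_list_ordering[OF zs, of s] block_orderingsD[OF s] by (auto simp: orderings_def)
  then show ?case using partition_onD1[OF part] by auto
next
  case (append xs ys u v)
  \<comment> \<open>Since \<open>rest\<close> is arbitrary, either half may be rotated to the front.
    The induction hypothesis for \<open>ys\<close> needs this, and the same rotation moves the
    junction of \<open>xs\<close> and \<open>ys\<close> to the seam.\<close>
  have cyc: "ys @ rest @ xs \<in> cyc (subst_list zs s)"
    using cyc_eqI[OF append.prems] cyc_self[of "ys @ rest @ xs"] cyc_append[of "ys @ rest" xs] by simp
  obtain G where G: "G \<in> I" "set xs \<subseteq> G" using append.IH(1)[of "ys @ rest"] append.prems by auto
  obtain H where H: "H \<in> I" "set ys \<subseteq> H" using append.IH(2)[of "rest @ xs"] cyc by auto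
  have "G = H"
  proof (rule ccontr)
    assume GH: "G \<noteq> H"
    let ?ys = "ys @ rest @ xs"
    have ne: "xs \<noteq> []" "ys \<noteq> []" using append.hyps plan_list_nonempty by blast+
    then have last: "last ?ys \<in> G" and hd: "hd ?ys \<in> H" using G H by (auto simp: subset_iff)
    then have "last ?ys \<notin> H" using GH G H block_unique by blast
    then obtain zs' where zs': "zs' \<in> cyc zs" "zs' \<noteq> []" "hd zs' = blk H" "?ys = subst_list zs' s"
      using subst_list_start[OF zs s cyc _ H(1) hd] ne by auto
    have sub: "set zs' \<subseteq> blk ` I" using cyc_ordering[OF zs'(1) zs] by (simp add: orderings_def verts_contract)
    then obtain K where K: "K \<in> I" "last zs' = blk K" using zs'(2) last_in_set by blast
    have "last ?ys \<in> K" using last_subst_list[OF zs'(2) sub s] zs'(4) K by simp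
    then have "last zs' = blk G" using last block_unique K G by blast
    \<comment> \<open>The edge between \<open>u\<close> and \<open>v\<close> descends to the blocks
      on the two sides of the seam of \<open>zs'\<close>, which the Hamiltonian condition
      forbids.\<close>
    moreover have "{blk G, blk H} \<in> edges (contract \<Gamma> I)"
      using edges_contract_iff[OF G(1) H(1)] GH append.hyps(3-5) G H by blast
    ultimately show False using ham zs' by metis
  qed
  then show ?case using G H by auto
qed

text \<open>Unique parsing: the first vertex determines the first block \<open>G\<close>, and both
  families give it a word of length \<open>card G\<close>, so the equation splits after that
  word.\<close>

lemma subst_list_inject:
  assumes s: "block_orderings s" and t: "block_orderings t"
    and "set xs \<subseteq> blk ` I" "set ys \<subseteq> blk ` I" "subst_list xs s = subst_list ys t"
  shows "xs = ys \<and> (\<forall>v\<in>set xs. s (unblk v) = t (unblk v))"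
  using assms(3-5)
proof (induction xs arbitrary: ys)
  case Nil
  have "ys = []"
  proof (rule ccontr)
    assume "ys \<noteq> []"
    then obtain G where "G \<in> I" "blk G \<in> set ys" using Nil.prems(2) by (cases ys) auto
    moreover have "set (subst_list ys t) = {}" using Nil.prems(3) by (simp add: subst_list_def)
    ultimately show False
      using block_orderingsD(2)[OF t] block_nonempty unfolding set_subst_list by fastforce
  qed
  then show ?case by simp
next
  case (Cons x xs)
  then obtain G where G: "G \<in> I" "x = blk G" by auto
  have sG: "s G \<noteq> []" using block_orderingsD[OF s G(1)] plan_list_nonempty by blast
  then obtain y ys' where ys: "ys = y # ys'"
    using Cons.prems(3) G by (cases ys) (auto simp: subst_list_def)
  then obtain H where H: "H \<in> I" "y = blk H" using Cons.prems by auto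
  have tH: "t H \<noteq> []" using block_orderingsD[OF t H(1)] plan_list_nonempty by blast
  have eq: "s G @ subst_list xs s = t H @ subst_list ys' t"
    using Cons.prems(3) G H by (simp add: subst_list_def ys)
  then have "hd (s G) = hd (t H)" using sG tH by (metis hd_append2)
  then have "hd (s G) \<in> G" "hd (s G) \<in> H"
    using sG tH block_orderingsD(2)[OF s G(1)] block_orderingsD(2)[OF t H(1)] hd_in_set by metis+
  then have [simp]: "H = G" using block_unique G H by blast
  have "length (s G) = length (t G)"
    using block_orderingsD[OF s G(1)] block_orderingsD[OF t G(1)] by (metis distinct_card)
  then have "s G = t G" "subst_list xs s = subst_list ys' t" using eq by simp_all
  then show ?case using Cons.IH[of ys'] Cons.prems G H by (auto simp: ys)
qed

end


section \<open>The basis of the free module and the existence of decompositions\<close>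

lemma (in graph_partition) mem_PiE_plan_orderings_iff:
  "p \<in> (\<Pi>\<^sub>E G\<in>I. plan_orderings (induced \<Gamma> G)) \<longleftrightarrow> p \<in> extensional I \<and> block_orderings p"
  using plan_orderings_induced_iff[OF simple block_subset]
  by (auto simp: PiE_iff block_orderings_def)

text \<open>The tube condition on \<open>I\<close> is absorbed into \<open>s\<close>: the entries of
  an admissible sequence form a tube.\<close>

lemma mem_composite_iff:
  assumes \<Gamma>: "connected_graph \<Gamma>"
  shows "(I, c, s) \<in> basis (composite CycHam_basis PlanEq_basis) \<Gamma> \<longleftrightarrow>
    graph_partition \<Gamma> I \<and> c \<in> basis CycHam_basis (contract \<Gamma> I) \<and>
    s \<in> extensional I \<and> graph_partition.block_orderings \<Gamma> I s"
proof -
  have mem: "(I, c, s) \<in> basis (composite CycHam_basis PlanEq_basis) \<Gamma> \<longleftrightarrow>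
      tube_partition \<Gamma> I \<and> c \<in> basis CycHam_basis (contract \<Gamma> I) \<and>
      s \<in> (\<Pi>\<^sub>E G\<in>I. plan_orderings (induced \<Gamma> G))"
    by (simp add: composite_def PlanEq_basis_def)
  have tubes: "tube_partition \<Gamma> I" if "graph_partition \<Gamma> I" "graph_partition.block_orderings \<Gamma> I s"
  proof -
    interpret graph_partition \<Gamma> I by fact
    have "tube \<Gamma> G" if "G \<in> I" for G
      using plan_list_tube[OF simple, of "s G"] block_orderingsD[OF \<open>block_orderings s\<close> that]
        block_subset[OF that] by simp
    then show ?thesis using part by (simp add: tube_partition_def)
  qed
  show ?thesis
    unfolding mem using tubes graph_partition_of_tubes[OF \<Gamma>]
      graph_partition.mem_PiE_plan_orderings_iff by blast
qed

lemma verts_contract_nonempty: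
  assumes "connected_graph \<Gamma>" "graph_partition \<Gamma> I"
  shows "verts (contract \<Gamma> I) \<noteq> {}" "I \<noteq> {}"
proof -
  interpret graph_partition \<Gamma> I by fact
  show "I \<noteq> {}" using assms(1) partition_onD1[OF part] by (auto simp: connected_graph_def)
  then show "verts (contract \<Gamma> I) \<noteq> {}" by (simp add: verts_contract)
qed

lemma composite_cases:
  assumes "connected_graph \<Gamma>" "(I, c, s) \<in> basis (composite CycHam_basis PlanEq_basis) \<Gamma>"
  obtains zs where "graph_partition \<Gamma> I" "zs \<in> orderings (contract \<Gamma> I)" "c = cyc zs" "card I \<noteq> 1"
    "\<forall>ys\<in>cyc zs. {last ys, hd ys} \<notin> edges (contract \<Gamma> I)"
    "s \<in> extensional I" "graph_partition.block_orderings \<Gamma> I s"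
proof -
  have *: "graph_partition \<Gamma> I" "c \<in> basis CycHam_basis (contract \<Gamma> I)"
    "s \<in> extensional I" "graph_partition.block_orderings \<Gamma> I s"
    using assms(2) by (simp_all add: mem_composite_iff[OF assms(1)])
  interpret graph_partition \<Gamma> I by fact
  have c: "card I \<noteq> 1" "c \<in> cyclic_orderings (contract \<Gamma> I)"
    "\<forall>ys\<in>c. {last ys, hd ys} \<notin> edges (contract \<Gamma> I)"
    using *(2) verts_contract_nonempty[OF assms(1) *(1)]
    by (simp_all add: basis_CycHam_iff simple_graph_contract card_verts_contract)
  from c(2) show ?thesis
    by (rule cyclic_orderings_cases) (use that * c in blast)
qed

text \<open>Minimality replaces the merging procedure: among all cuts into admissible arcs, one with
  the fewest arcs is taken. Cyclic neighbours joined by an edge would yield a shorter cut, and a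
  single arc would be an admissible representative.\<close>

lemma decomposition_exists:
  assumes \<Gamma>: "connected_graph \<Gamma>" and c: "c \<in> cyclic_orderings \<Gamma>"
    and not_plan: "\<And>xs. xs \<in> c \<Longrightarrow> xs \<notin> plan_orderings \<Gamma>"
  obtains I d s where "(I, d, s) \<in> basis (composite CycHam_basis PlanEq_basis) \<Gamma>" "subst_cyc d s = c"
proof -
  have simple: "simple_graph \<Gamma>" and ne: "verts \<Gamma> \<noteq> {}" using \<Gamma> by (simp_all add: connected_graph_def)
  obtain xs where xs: "xs \<in> orderings \<Gamma>" "c = cyc xs" by (rule cyclic_orderings_cases[OF c])
  have ord: "ys \<in> orderings \<Gamma>" if "ys \<in> c" for ys using cyc_ordering that xs by blast
  \<comment> \<open>The concatenation has to lie in \<open>c\<close>, not to equal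
    \<open>xs\<close>: merging the last arc with the first changes the representative.\<close>
  define good where "good ls \<longleftrightarrow> (\<forall>l\<in>set ls. plan_list (edges \<Gamma>) l) \<and> concat ls \<in> c" for ls
  have "concat (map (\<lambda>v. [v]) xs) = xs" by simp
  then have "good (map (\<lambda>v. [v]) xs)"
    using cyc_self[of xs] by (simp add: good_def plan_list.single xs(2))
  then obtain ls where ls: "good ls" and min: "\<And>ls'. good ls' \<Longrightarrow> length ls \<le> length ls'"
    using ex_has_least_nat[of good _ length] by blast
  have plan: "plan_list (edges \<Gamma>) l" if "l \<in> set ls" for l using ls that by (simp add: good_def)
  have cyc: "cyc (concat ls) = c" using ls by (simp add: good_def xs(2) cyc_eqI)
  have concat: "distinct (concat ls)" "set (concat ls) = verts \<Gamma>"
    using ls ord[of "concat ls"] by (simp_all add: good_def orderings_def)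
  have "ls \<noteq> []" using concat(2) ne by auto
  moreover have "length ls \<noteq> 1"
  proof
    assume "length ls = 1"
    then obtain l where "ls = [l]" by (auto simp: length_Suc_conv)
    then have "plan_list (edges \<Gamma>) l" "l \<in> c" using ls by (simp_all add: good_def)
    then show False using not_plan ord plan_orderings_iff[OF simple] by blast
  qed
  ultimately have len: "length ls \<ge> 2" by (cases ls; cases "tl ls") auto
  have nonadj: "\<not> (\<exists>u\<in>set (last ls'). \<exists>v\<in>set (hd ls'). {u, v} \<in> edges \<Gamma>)" if ls': "ls' \<in> cyc ls" for ls'
  proof
    assume "\<exists>u\<in>set (last ls'). \<exists>v\<in>set (hd ls'). {u, v} \<in> edges \<Gamma>"
    then obtain u v where uv: "u \<in> set (last ls')" "v \<in> set (hd ls')" "{u, v} \<in> edges \<Gamma>" by blast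
    obtain as bs where as: "ls = as @ bs" "ls' = bs @ as" using ls' unfolding mem_cyc_iff by blast
    have l: "length ls' = length ls" "set ls' = set ls" by (auto simp: as)
    \<comment> \<open>With at least two arcs, the last and the first are separate entries of the
      list, so merging them lowers its length.\<close>
    obtain x ms y where ms: "ls' = x # ms @ [y]"
    proof (cases ls')
      case (Cons x ms')
      with len l(1) have "ms' \<noteq> []" by auto
      then show ?thesis using that[of x "butlast ms'" "last ms'"] Cons by simp
    qed (use len l(1) in simp)
    have "cyc (concat ls') = c" using cyc cyc_append[of "concat as" "concat bs"] by (simp add: as)
    then have "cyc (y @ x @ concat ms) = c" using cyc_append[of y "x @ concat ms"] by (simp add: ms)
    then have "y @ x @ concat ms \<in> c" using cyc_self by blast
    moreover have "plan_list (edges \<Gamma>) (y @ x)"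
      using uv plan l(2) by (intro plan_list.append[of _ _ _ u v]) (auto simp: ms)
    ultimately have "good ((y @ x) # ms)"
      using plan l(2) by (auto simp: good_def ms)
    then show False using min l(1) by (fastforce simp: ms)
  qed
  have "[] \<notin> set ls" using plan plan_list_nonempty by blast
  then have dist: "distinct ls"
    and disj: "\<And>l m. l \<in> set ls \<Longrightarrow> m \<in> set ls \<Longrightarrow> l \<noteq> m \<Longrightarrow> set l \<inter> set m = {}"
    using concat(1) by (simp_all add: distinct_concat_iff)
  have ne_l: "set l \<noteq> {}" if "l \<in> set ls" for l using \<open>[] \<notin> set ls\<close> that by auto
  \<comment> \<open>Different arcs are disjoint and nonempty, so an arc is determined by its vertex
    set; \<open>inv_into\<close> in the definition of \<open>s\<close> then returns the arc over a
    block.\<close>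
  have inj: "inj_on set (set ls)"
    using disj ne_l by (intro inj_onI) (metis Int_absorb)
  define I where "I = set ` set ls"
  define s where "s = (\<lambda>G\<in>I. inv_into (set ls) set G)"
  define zs where "zs = map (\<lambda>l. blk (set l)) ls"
  have part: "partition_on (verts \<Gamma>) I"
  proof (rule partition_onI)
    show "\<Union>I = verts \<Gamma>" using concat(2) by (simp add: I_def)
    show "disjnt p q" if "p \<in> I" "q \<in> I" "p \<noteq> q" for p q
      using that disj by (auto simp: I_def disjnt_def)
    show "{} \<notin> I" using ne_l by (auto simp: I_def)
  qed
  interpret graph_partition \<Gamma> I using simple part by unfold_locales
  have s: "s (set l) = l" if "l \<in> set ls" for l using that inj by (simp add: s_def I_def)
  have blocks: "block_orderings s"
    unfolding block_orderings_def using concat(1) plan by (auto simp: I_def s distinct_concat_iff)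
  have inj_blk: "inj_on (\<lambda>l. blk (set l)) (set ls)"
    using comp_inj_on[OF inj, of blk] inj_on_blk by (simp add: I_def comp_def)
  then have zs: "zs \<in> orderings (contract \<Gamma> I)"
    using dist by (simp add: orderings_def zs_def distinct_map verts_contract I_def image_image)
  have "map (\<lambda>v. s (unblk v)) zs = ls"
    unfolding zs_def map_map by (rule map_idI) (simp add: s I_def)
  then have subst: "subst_cyc (cyc zs) s = c"
    unfolding subst_cyc_cyc subst_list_def by (simp add: cyc)
  have "card I \<noteq> 1" using len inj dist by (simp add: I_def card_image distinct_card)
  moreover have "{last ys, hd ys} \<notin> edges (contract \<Gamma> I)" if "ys \<in> cyc zs" for ys
  proof -
    obtain ls' where ls': "ls' \<in> cyc ls" "ys = map (\<lambda>l. blk (set l)) ls'"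
      using \<open>ys \<in> cyc zs\<close> map_cyc[of "\<lambda>l. blk (set l)" ls] unfolding zs_def by blast
    have "set ls' = set ls" by (rule set_cyc[OF ls'(1)])
    then have "ls' \<noteq> []" using len by auto
    then have I: "set (last ls') \<in> I" "set (hd ls') \<in> I"
      using \<open>set ls' = set ls\<close> last_in_set[of ls'] hd_in_set[of ls'] by (simp_all add: I_def)
    show ?thesis
      using nonadj[OF ls'(1)] \<open>ls' \<noteq> []\<close> edges_contract_iff[OF I]
      by (simp add: ls'(2) last_map hd_map)
  qed
  ultimately have "cyc zs \<in> basis CycHam_basis (contract \<Gamma> I)"
    using verts_contract_nonempty[OF \<Gamma> graph_partition_axioms] zs
    by (simp add: basis_CycHam_iff simple_graph_contract card_verts_contract cyclic_orderings_def)
  then have "(I, cyc zs, s) \<in> basis (composite CycHam_basis PlanEq_basis) \<Gamma>"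
    using blocks graph_partition_axioms by (simp add: mem_composite_iff[OF \<Gamma>] s_def)
  then show ?thesis using that subst by blast
qed

section \<open>Uniqueness of decompositions\<close>

lemma decomposition_refines:
  assumes \<Gamma>: "connected_graph \<Gamma>"
    and x: "(I, c, s) \<in> basis (composite CycHam_basis PlanEq_basis) \<Gamma>"
    and xs: "plan_list (edges \<Gamma>) xs" "xs @ rest \<in> subst_cyc c s"
  shows "\<exists>G\<in>I. set xs \<subseteq> G"
proof -
  obtain zs where zs: "graph_partition \<Gamma> I" "zs \<in> orderings (contract \<Gamma> I)" "c = cyc zs"
    "\<forall>ys\<in>cyc zs. {last ys, hd ys} \<notin> edges (contract \<Gamma> I)" "graph_partition.block_orderings \<Gamma> I s"
    using composite_cases[OF \<Gamma> x] by metis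
  from zs(1) interpret graph_partition \<Gamma> I .
  show ?thesis using arc_in_block[OF zs(2,5,4) xs(1)] xs(2) by (simp add: zs(3) subst_cyc_cyc)
qed

text \<open>An admissible representative is an arc through all vertices, hence would lie in one
  block. That block would be the only one, which the convention for the one-vertex graph
  excludes.\<close>

lemma decomposition_not_plan:
  assumes \<Gamma>: "connected_graph \<Gamma>"
    and x: "(I, c, s) \<in> basis (composite CycHam_basis PlanEq_basis) \<Gamma>"
    and xs: "xs \<in> subst_cyc c s"
  shows "xs \<notin> plan_orderings \<Gamma>"
proof
  assume plan: "xs \<in> plan_orderings \<Gamma>"
  obtain zs where zs: "graph_partition \<Gamma> I" "card I \<noteq> 1" using composite_cases[OF \<Gamma> x] by metis
  from zs(1) interpret graph_partition \<Gamma> I .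
  have "set xs = verts \<Gamma>" "plan_list (edges \<Gamma>) xs"
    using plan plan_orderings_iff[OF simple] by (auto simp: orderings_def)
  then obtain G where G: "G \<in> I" "verts \<Gamma> \<subseteq> G"
    using decomposition_refines[OF \<Gamma> x, of xs "[]"] xs by auto
  have "H = G" if "H \<in> I" for H
    using that G block_unique[OF that G(1)] block_nonempty[OF that] block_subset[OF that] by blast
  then have "I = {G}" using G(1) by blast
  then show False using zs(2) by simp
qed

text \<open>The word \<open>s G\<close> is an admissible arc of the common cyclic ordering, so the
  second decomposition contains it in one of its blocks.\<close>

lemma decomposition_blocks_refine:
  assumes \<Gamma>: "connected_graph \<Gamma>"
    and x: "(I, c, s) \<in> basis (composite CycHam_basis PlanEq_basis) \<Gamma>"
    and y: "(J, d, t) \<in> basis (composite CycHam_basis PlanEq_basis) \<Gamma>"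
    and eq: "subst_cyc c s = subst_cyc d t" and G: "G \<in> I"
  shows "\<exists>H\<in>J. G \<subseteq> H"
proof -
  obtain zs where zs: "graph_partition \<Gamma> I" "zs \<in> orderings (contract \<Gamma> I)" "c = cyc zs"
    "graph_partition.block_orderings \<Gamma> I s"
    using composite_cases[OF \<Gamma> x] by metis
  from zs(1) interpret graph_partition \<Gamma> I .
  have "blk G \<in> set zs" using zs(2) G by (simp add: orderings_def verts_contract)
  then obtain as bs where as: "zs = as @ blk G # bs" by (meson split_list)
  have "blk G # bs @ as \<in> c"
    unfolding zs(3) mem_cyc_iff as by (intro exI[of _ as] exI[of _ "blk G # bs"]) simp
  then have "subst_list (blk G # bs @ as) s \<in> subst_cyc c s"
    unfolding subst_cyc_def by (rule UN_I) (rule cyc_self)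
  then have "s G @ subst_list (bs @ as) s \<in> subst_cyc d t"
    using G by (simp add: eq subst_list_def)
  from decomposition_refines[OF \<Gamma> y block_orderingsD(3)[OF zs(4) G] this]
  show ?thesis using block_orderingsD(2)[OF zs(4) G] by simp
qed

text \<open>Going up from \<open>G\<close> to some \<open>H\<close> in \<open>J\<close> and on to
  some \<open>G'\<close> in \<open>I\<close> gives \<open>G \<subseteq> H \<subseteq> G'\<close>;
  disjointness of the blocks of \<open>I\<close> forces all three to agree.\<close>

lemma partition_on_subset_of_refines:
  assumes I: "partition_on A I" and "\<And>G. G \<in> I \<Longrightarrow> \<exists>H\<in>J. G \<subseteq> H" "\<And>H. H \<in> J \<Longrightarrow> \<exists>G\<in>I. H \<subseteq> G"
  shows "I \<subseteq> J"
proof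
  fix G assume G: "G \<in> I"
  then obtain H G' where H: "H \<in> J" "G \<subseteq> H" "G' \<in> I" "H \<subseteq> G'" using assms(2,3) by meson
  have "G = G' \<or> G \<inter> G' = {}" using partition_onD2[OF I] G H(3) unfolding disjoint_def by blast
  moreover have "G \<noteq> {}" using G partition_onD3[OF I] by blast
  ultimately have "G = G'" using H by blast
  then show "G \<in> J" using H by auto
qed

text \<open>Mutual refinement gives \<open>I = J\<close>. The list \<open>subst_list zs' t\<close>
  is then read as a representative for the first decomposition: it starts in one block and ends in
  another, so it is also opened at a block boundary for \<open>s\<close>, and unique parsing
  applies.\<close>

lemma decomposition_unique:
  assumes \<Gamma>: "connected_graph \<Gamma>"
  shows "inj_on (\<lambda>(I, c, s). subst_cyc c s) (basis (composite CycHam_basis PlanEq_basis) \<Gamma>)"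
proof (rule inj_onI)
  fix a b
  assume ab: "a \<in> basis (composite CycHam_basis PlanEq_basis) \<Gamma>"
    "b \<in> basis (composite CycHam_basis PlanEq_basis) \<Gamma>"
    "(\<lambda>(I, c, s). subst_cyc c s) a = (\<lambda>(I, c, s). subst_cyc c s) b"
  obtain I c s J d t where pairs: "a = (I, c, s)" "b = (J, d, t)" by (metis prod_cases3)
  note x = ab(1)[unfolded pairs] and y = ab(2)[unfolded pairs] and eq = ab(3)[unfolded pairs prod.case]
  obtain zs where zs: "graph_partition \<Gamma> I" "zs \<in> orderings (contract \<Gamma> I)" "c = cyc zs"
    "card I \<noteq> 1" "s \<in> extensional I" "graph_partition.block_orderings \<Gamma> I s"
    using composite_cases[OF \<Gamma> x] by metis
  from zs(1) interpret graph_partition \<Gamma> I .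
  obtain zs' where zs': "graph_partition \<Gamma> J" "zs' \<in> orderings (contract \<Gamma> J)" "d = cyc zs'"
    "t \<in> extensional J" "graph_partition.block_orderings \<Gamma> J t"
    using composite_cases[OF \<Gamma> y] by metis
  have refines: "\<And>G. G \<in> I \<Longrightarrow> \<exists>H\<in>J. G \<subseteq> H" "\<And>H. H \<in> J \<Longrightarrow> \<exists>G\<in>I. H \<subseteq> G"
    using decomposition_blocks_refine[OF \<Gamma> x y eq] decomposition_blocks_refine[OF \<Gamma> y x eq[symmetric]]
    by simp_all
  have "I = J"
    using partition_on_subset_of_refines[OF part refines]
      partition_on_subset_of_refines[OF graph_partition.part[OF zs'(1)] refines(2,1)] by simp
  note zs' = zs'[folded this]
  have zs'_ne: "zs' \<noteq> []" and sub': "set zs' \<subseteq> blk ` I"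
    using zs'(2) verts_contract_nonempty(2)[OF \<Gamma> zs(1)] by (auto simp: orderings_def verts_contract)
  then obtain G us where G: "G \<in> I" "zs' = blk G # us" by (cases zs') auto
  \<comment> \<open>A second block guarantees that the list ends outside its first block; this uses
    \<open>card I \<noteq> 1\<close>.\<close>
  have "us \<noteq> []"
  proof
    assume "us = []"
    then have "verts (contract \<Gamma> I) = {blk G}" using zs'(2) G by (simp add: orderings_def)
    then show False using zs(4) card_verts_contract by simp
  qed
  then have "last us \<in> set us" by simp
  moreover have "blk G \<notin> set us" "set us \<subseteq> blk ` I"
    using sub' zs'(2) G(2) by (auto simp: orderings_def)
  ultimately have "last us \<in> blk ` I" "last us \<noteq> blk G" by auto
  then obtain H where H: "H \<in> I" "last us = blk H" "H \<noteq> G" by auto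
  let ?ys = "subst_list zs' t"
  have "cyc (subst_list zs s) = cyc ?ys"
    using eq unfolding zs(3) zs'(3) subst_cyc_cyc .
  then have ys: "?ys \<in> cyc (subst_list zs s)" by (simp only: cyc_self)
  have tG: "t G \<noteq> []" "set (t G) = G"
    using block_orderingsD[OF zs'(5) G(1)] plan_list_nonempty by blast+
  then have hd: "?ys \<noteq> []" "hd ?ys \<in> G"
    using hd_in_set[of "t G"] G by (simp_all add: subst_list_def)
  have "last ?ys \<in> H"
    using last_subst_list[OF zs'_ne sub' zs'(5)] H(1,2) G(2) \<open>us \<noteq> []\<close> by simp
  then have "last ?ys \<notin> G" using block_unique H G(1) by blast
  then obtain zs1 where zs1: "zs1 \<in> cyc zs" "?ys = subst_list zs1 s"
    using subst_list_start[OF zs(2,6) ys hd(1) G(1) hd(2)] by metis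
  have sub1: "set zs1 = blk ` I"
    using cyc_ordering[OF zs1(1) zs(2)] by (simp add: orderings_def verts_contract)
  have st: "zs1 = zs'" "\<forall>v\<in>set zs1. s (unblk v) = t (unblk v)"
    using subst_list_inject[OF zs(6) zs'(5) _ sub' zs1(2)[symmetric]] sub1 by auto
  have "s = t"
  proof (rule extensionalityI[OF zs(5) zs'(4)])
    fix G assume "G \<in> I"
    then show "s G = t G" using st(2) sub1 by auto
  qed
  moreover have "c = d" using zs(3) zs'(3) cyc_eqI[OF zs1(1)] st(1) by simp
  ultimately show "a = b" using \<open>I = J\<close> by (simp add: pairs)
qed


section \<open>Linear extension of maps between bases\<close>

lemma sum_morphism:
  assumes "h 0 = 0" "\<And>x y. h (x + y) = h x + h y"
  shows "h (\<Sum>i\<in>A. g i) = (\<Sum>i\<in>A. h (g i))"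
  using sum_comp_morphism[of h g A] assms by (simp add: comp_def)

lemma keys_sum_subset:
  "Poly_Mapping.keys (\<Sum>i\<in>A. g i) \<subseteq> (\<Union>i\<in>A. Poly_Mapping.keys (g i))"
proof (induction A rule: infinite_finite_induct)
  case (insert i A)
  then show ?case using Poly_Mapping.keys_add[of "g i" "sum g A"] by auto
qed auto

text \<open>Coefficients may cancel in \<open>m + n\<close>, so the three key sets differ; because
  \<open>h x 0 = 0\<close>, every sum can be taken over the union of the keys of \<open>m\<close>
  and \<open>n\<close>.\<close>

lemma sum_keys_add:
  fixes m n :: "'x \<Rightarrow>\<^sub>0 'k::comm_monoid_add" and h :: "'x \<Rightarrow> 'k \<Rightarrow> 'c::comm_monoid_add"
  assumes "\<And>x. h x 0 = 0" "\<And>x a b. h x (a + b) = h x a + h x b"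
  shows "(\<Sum>x\<in>Poly_Mapping.keys (m + n). h x (Poly_Mapping.lookup (m + n) x)) =
    (\<Sum>x\<in>Poly_Mapping.keys m. h x (Poly_Mapping.lookup m x)) +
    (\<Sum>x\<in>Poly_Mapping.keys n. h x (Poly_Mapping.lookup n x))"
proof -
  let ?K = "Poly_Mapping.keys m \<union> Poly_Mapping.keys n"
  have *: "(\<Sum>x\<in>Poly_Mapping.keys l. h x (Poly_Mapping.lookup l x)) =
      (\<Sum>x\<in>?K. h x (Poly_Mapping.lookup l x))" if "Poly_Mapping.keys l \<subseteq> ?K" for l
    using that by (intro sum.mono_neutral_left) (auto simp: assms(1) in_keys_iff)
  have "(\<Sum>x\<in>Poly_Mapping.keys (m + n). h x (Poly_Mapping.lookup (m + n) x)) =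
      (\<Sum>x\<in>?K. h x (Poly_Mapping.lookup (m + n) x))"
    by (rule *[OF Poly_Mapping.keys_add])
  then show ?thesis
    by (simp add: * lookup_add assms(2) sum.distrib)
qed

text \<open>The linear extension of a map of bases, adding up coefficients over each fibre.
  Transport in \<open>linearize\<close> has this form too, so the same lemmas serve transport and
  the comparison maps.\<close>

definition push :: "('x \<Rightarrow> 'y) \<Rightarrow> ('x \<Rightarrow>\<^sub>0 'k::comm_monoid_add) \<Rightarrow> ('y \<Rightarrow>\<^sub>0 'k)" where
  "push f m = (\<Sum>x\<in>Poly_Mapping.keys m. Poly_Mapping.single (f x) (Poly_Mapping.lookup m x))"

lemma push_zero [simp]: "push f 0 = 0"
  by (simp add: push_def)

lemma push_add: "push f (m + n) = push f m + push f n"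
  unfolding push_def by (rule sum_keys_add) (simp_all add: single_add)

lemma push_sum: "push f (\<Sum>i\<in>A. g i) = (\<Sum>i\<in>A. push f (g i))"
  by (rule sum_morphism) (simp_all add: push_add)

lemma push_single [simp]: "push f (Poly_Mapping.single x a) = Poly_Mapping.single (f x) a"
  by (simp add: push_def)

lemma push_cong: "(\<And>x. x \<in> Poly_Mapping.keys m \<Longrightarrow> f x = g x) \<Longrightarrow> push f m = push g m"
  by (simp add: push_def)

lemma push_push: "push g (push f m) = push (\<lambda>x. g (f x)) m"
  by (simp add: push_def[of f] push_sum) (simp add: push_def)

lemma keys_push: "Poly_Mapping.keys (push f m) \<subseteq> f ` Poly_Mapping.keys m"
  unfolding push_def using keys_sum_subset by (fastforce split: if_splits)

lemma lookup_push_eq_0: "y \<notin> f ` Poly_Mapping.keys m \<Longrightarrow> Poly_Mapping.lookup (push f m) y = 0"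
  using keys_push[of f m] by (auto simp: in_keys_iff)

text \<open>Injectivity on \<open>B\<close> leaves \<open>x\<close> as the only possible key over
  \<open>f x\<close>, so no other coefficient is added.\<close>

lemma lookup_push:
  assumes "inj_on f B" "Poly_Mapping.keys m \<subseteq> B" "x \<in> B"
  shows "Poly_Mapping.lookup (push f m) (f x) = Poly_Mapping.lookup m x"
proof -
  have "Poly_Mapping.lookup (push f m) (f x) =
      (\<Sum>z\<in>Poly_Mapping.keys m. if z = x then Poly_Mapping.lookup m z else 0)"
    unfolding push_def lookup_sum lookup_single
    using assms by (intro sum.cong refl) (auto simp: inj_on_def when_def)
  then show ?thesis by (simp add: in_keys_iff)
qed

lemma push_ident [simp]: "push (\<lambda>x. x) m = m"
  by (rule poly_mapping_eqI) (use lookup_push[of "\<lambda>x. x" UNIV] in simp)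

lemma poly_mapping_eqI_on:
  assumes "Poly_Mapping.keys m \<subseteq> B" "Poly_Mapping.keys n \<subseteq> B"
    and "\<And>x. x \<in> B \<Longrightarrow> Poly_Mapping.lookup m x = Poly_Mapping.lookup n x"
  shows "m = n"
proof (rule poly_mapping_eqI)
  fix x show "Poly_Mapping.lookup m x = Poly_Mapping.lookup n x"
  proof (cases "x \<in> B")
    case False
    then have "x \<notin> Poly_Mapping.keys m" "x \<notin> Poly_Mapping.keys n" using assms(1,2) by blast+
    then show ?thesis by (simp add: in_keys_iff)
  qed (rule assms(3))
qed

lemma push_surj:
  assumes "Poly_Mapping.keys m \<subseteq> f ` B"
  obtains b where "Poly_Mapping.keys b \<subseteq> B" "push f b = m"
proof
  let ?b = "push (inv_into B f) m"
  show "Poly_Mapping.keys ?b \<subseteq> B"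
  proof (rule order_trans[OF keys_push], rule image_subsetI)
    fix y assume "y \<in> Poly_Mapping.keys m"
    then have "y \<in> f ` B" using assms by (rule subsetD[rotated])
    then show "inv_into B f y \<in> B" by (rule inv_into_into)
  qed
  have "push f ?b = push (\<lambda>x. x) m"
    unfolding push_push by (intro push_cong f_inv_into_f subsetD[OF assms])
  then show "push f ?b = m" by simp
qed

text \<open>Keys of \<open>m\<close> in the image of \<open>A\<close> go to the first summand, the
  remaining ones, which lie in the image of \<open>B\<close>, to the second;
  \<open>push_surj\<close> lifts each part.\<close>

lemma push_pair_surj:
  assumes "Poly_Mapping.keys m \<subseteq> f ` A \<union> g ` B"
  obtains a b where "Poly_Mapping.keys a \<subseteq> A" "Poly_Mapping.keys b \<subseteq> B" "push f a + push g b = m"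
proof -
  let ?K = "Poly_Mapping.keys m"
  define part where "part S = (\<Sum>x\<in>S. Poly_Mapping.single x (Poly_Mapping.lookup m x))" for S
  have keys: "Poly_Mapping.keys (part S) \<subseteq> S" for S
    unfolding part_def by (rule order_trans[OF keys_sum_subset]) auto
  have "Poly_Mapping.keys (part (?K \<inter> f ` A)) \<subseteq> f ` A"
    "Poly_Mapping.keys (part (?K - f ` A)) \<subseteq> g ` B"
    using assms by (blast intro!: order_trans[OF keys])+
  then obtain a b where "Poly_Mapping.keys a \<subseteq> A" "push f a = part (?K \<inter> f ` A)"
    "Poly_Mapping.keys b \<subseteq> B" "push g b = part (?K - f ` A)"
    by (metis push_surj)
  moreover have "part (?K \<inter> f ` A) + part (?K - f ` A) = push (\<lambda>x. x) m"
    by (simp only: part_def push_def sum.Int_Diff[symmetric] finite_keys)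
  ultimately show ?thesis using that by simp
qed

lemma lookup_free_scale: "Poly_Mapping.lookup (free_scale c m) x = c * Poly_Mapping.lookup m x"
  by (simp add: free_scale_def Poly_Mapping.map.rep_eq when_def)

lemma free_scale_add: "free_scale c (m + n) = free_scale c m + free_scale c n"
  by (rule poly_mapping_eqI) (simp add: lookup_free_scale lookup_add distrib_left)

lemma keys_free_scale: "Poly_Mapping.keys (free_scale c m) \<subseteq> Poly_Mapping.keys m"
  by (auto simp: in_keys_iff lookup_free_scale)

lemma push_free_scale: "push f (free_scale c m) = free_scale c (push f m)"
proof -
  have zero: "free_scale c 0 = 0"
    by (rule poly_mapping_eqI) (simp add: lookup_free_scale)
  have single: "free_scale c (Poly_Mapping.single x a) = Poly_Mapping.single x (c * a)" for x a
    by (rule poly_mapping_eqI) (simp add: lookup_free_scale lookup_single when_def)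
  have "push f (free_scale c m) =
      (\<Sum>x\<in>Poly_Mapping.keys m. Poly_Mapping.single (f x) (c * Poly_Mapping.lookup m x))"
    unfolding push_def lookup_free_scale using keys_free_scale
    by (rule sum.mono_neutral_left[rotated]) (auto simp: in_keys_iff lookup_free_scale)
  also have "\<dots> = free_scale c (push f m)"
    unfolding push_def by (simp add: sum_morphism[of "free_scale c"] free_scale_add zero single)
  finally show ?thesis .
qed


section \<open>Isomorphisms of linearized modules\<close>

text \<open>Cancelling \<Psi> against its inverse after an operation of \<open>M\<close> requires
  the result to lie in the space of \<open>M\<close>. \<open>is_rmodule_iso\<close> does not contain
  this closure, so it is assumed for each operation.\<close>

lemma is_rmodule_iso_inv_into:
  fixes M :: "('a, 'k, 'm::ab_group_add, 'p) rmodule" and N :: "('a, 'k, 'n::ab_group_add, 'p) rmodule"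
  assumes iso: "is_rmodule_iso P M N \<Psi>"
    and add: "\<And>\<Gamma> x y. \<lbrakk>connected_graph \<Gamma>; x \<in> space M \<Gamma>; y \<in> space M \<Gamma>\<rbrakk> \<Longrightarrow> x + y \<in> space M \<Gamma>"
    and scale: "\<And>\<Gamma> c x. \<lbrakk>connected_graph \<Gamma>; x \<in> space M \<Gamma>\<rbrakk> \<Longrightarrow> scale M c x \<in> space M \<Gamma>"
    and transport: "\<And>\<Gamma> \<Delta> f x. \<lbrakk>connected_graph \<Gamma>; connected_graph \<Delta>; graph_iso f \<Gamma> \<Delta>; x \<in> space M \<Gamma>\<rbrakk>
      \<Longrightarrow> transport M f x \<in> space M \<Delta>"
    and act: "\<And>\<Gamma> I x p. \<lbrakk>connected_graph \<Gamma>; tube_partition \<Gamma> I; x \<in> space M (contract \<Gamma> I);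
      \<forall>G\<in>I. p G \<in> space P (induced \<Gamma> G)\<rbrakk> \<Longrightarrow> act M \<Gamma> I x p \<in> space M \<Gamma>"
  shows "is_rmodule_iso P N M (\<lambda>\<Gamma>. inv_into (space M \<Gamma>) (\<Psi> \<Gamma>))"
proof -
  let ?inv = "\<lambda>\<Gamma>. inv_into (space M \<Gamma>) (\<Psi> \<Gamma>)"
  have bij: "bij_betw (\<Psi> \<Gamma>) (space M \<Gamma>) (space N \<Gamma>)" if "connected_graph \<Gamma>" for \<Gamma>
    using iso that by (simp add: is_rmodule_iso_def)
  have inv: "?inv \<Gamma> (\<Psi> \<Gamma> x) = x" if "connected_graph \<Gamma>" "x \<in> space M \<Gamma>" for \<Gamma> x
    using bij[OF that(1)] that(2) by (simp add: bij_betw_def)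
  have pre: "\<exists>x'\<in>space M \<Gamma>. x = \<Psi> \<Gamma> x'" if "connected_graph \<Gamma>" "x \<in> space N \<Gamma>" for \<Gamma> x
    using bij[OF that(1)] that(2) by (auto simp: bij_betw_def)
  show ?thesis
    unfolding is_rmodule_iso_def
  proof (intro conjI allI impI ballI; (elim conjE)?)
    fix \<Gamma> :: "'a vgraph" assume \<Gamma>: "connected_graph \<Gamma>"
    show "bij_betw (?inv \<Gamma>) (space N \<Gamma>) (space M \<Gamma>)"
      by (rule bij_betw_inv_into[OF bij[OF \<Gamma>]])
    fix x assume x: "x \<in> space N \<Gamma>"
    then obtain x' where x': "x' \<in> space M \<Gamma>" "x = \<Psi> \<Gamma> x'" using pre \<Gamma> by blast
    have "scale N c x = \<Psi> \<Gamma> (scale M c x')" for c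
      using iso \<Gamma> x' by (simp add: is_rmodule_iso_def)
    then show "?inv \<Gamma> (scale N c x) = scale M c (?inv \<Gamma> x)" for c
      using inv \<Gamma> x' scale by simp
    fix y assume y: "y \<in> space N \<Gamma>"
    then obtain y' where y': "y' \<in> space M \<Gamma>" "y = \<Psi> \<Gamma> y'" using pre \<Gamma> by blast
    have "x + y = \<Psi> \<Gamma> (x' + y')"
      using iso \<Gamma> x' y' by (simp add: is_rmodule_iso_def)
    then show "?inv \<Gamma> (x + y) = ?inv \<Gamma> x + ?inv \<Gamma> y"
      using inv \<Gamma> x' y' add by simp
  next
    fix \<Gamma> \<Delta> :: "'a vgraph" and f x
    assume *: "connected_graph \<Gamma>" "connected_graph \<Delta>" "graph_iso f \<Gamma> \<Delta>" "x \<in> space N \<Gamma>"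
    then obtain x' where x': "x' \<in> space M \<Gamma>" "x = \<Psi> \<Gamma> x'" using pre by blast
    have "transport N f x = \<Psi> \<Delta> (transport M f x')"
      using iso * x' by (simp add: is_rmodule_iso_def)
    then show "?inv \<Delta> (transport N f x) = transport M f (?inv \<Gamma> x)"
      using inv * x' transport by simp
  next
    fix \<Gamma> :: "'a vgraph" and I x p
    assume *: "x \<in> space N (contract \<Gamma> I)" "\<forall>G\<in>I. p G \<in> space P (induced \<Gamma> G)"
      "connected_graph \<Gamma>" "tube_partition \<Gamma> I"
    then have c: "connected_graph (contract \<Gamma> I)" by (simp add: connected_contract)
    obtain x' where x': "x' \<in> space M (contract \<Gamma> I)" "x = \<Psi> (contract \<Gamma> I) x'"
      using pre c * by blast
    have "act N \<Gamma> I x p = \<Psi> \<Gamma> (act M \<Gamma> I x' p)"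
      using iso * x' by (simp add: is_rmodule_iso_def)
    then show "?inv \<Gamma> (act N \<Gamma> I x p) = act M \<Gamma> I (?inv (contract \<Gamma> I) x) p"
      using inv * c x' act by simp
  qed
qed

lemma transport_linearize: "transport (linearize M) f = push (relabel M f)"
  by (simp add: linearize_def push_def fun_eq_iff)

lemma scale_linearize: "scale (linearize M) = free_scale"
  by (simp add: linearize_def)

lemma space_linearize: "space (linearize M) \<Gamma> = {m. Poly_Mapping.keys m \<subseteq> basis M \<Gamma>}"
  by (simp add: linearize_def)

lemma act_linearize_add:
  "act (linearize M) \<Gamma> I (m + n) p = act (linearize M) \<Gamma> I m p + act (linearize M) \<Gamma> I n p"
  unfolding linearize_def rmodule.select_convs
  by (rule sum_keys_add) (simp_all add: distrib_right single_add sum.distrib)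

lemma act_linearize_single:
  "act (linearize M) \<Gamma> I (Poly_Mapping.single x a) p =
    (\<Sum>s\<in>(\<Pi>\<^sub>E G\<in>I. Poly_Mapping.keys (p G)).
      Poly_Mapping.single (bact M \<Gamma> I x s) (a * (\<Prod>G\<in>I. Poly_Mapping.lookup (p G) (s G))))"
  by (simp add: linearize_def)

lemma act_linearize_sum:
  "act (linearize M) \<Gamma> I (\<Sum>i\<in>A. g i) p = (\<Sum>i\<in>A. act (linearize M) \<Gamma> I (g i) p)"
proof (rule sum_morphism)
  show "act (linearize M) \<Gamma> I 0 p = 0" by (simp add: linearize_def)
qed (rule act_linearize_add)

text \<open>The conditions on a map of bases that make its linear extension an injective module
  morphism. Closure of the bases of \<open>N\<close> is included because the record
  \<open>bmodule\<close> does not impose it and the passage to the inverse relies on it.\<close>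

definition bmodule_embedding ::
  "('a, 'q) bcontractad \<Rightarrow> ('a, 'x, 'q) bmodule \<Rightarrow> ('a, 'y, 'q) bmodule \<Rightarrow> ('x \<Rightarrow> 'y) \<Rightarrow> bool" where
  "bmodule_embedding P N M \<psi> \<longleftrightarrow>
     (\<forall>\<Gamma>. connected_graph \<Gamma> \<longrightarrow> inj_on \<psi> (basis N \<Gamma>)) \<and>
     (\<forall>\<Gamma> \<Delta> f. connected_graph \<Gamma> \<and> connected_graph \<Delta> \<and> graph_iso f \<Gamma> \<Delta> \<longrightarrow>
        (\<forall>x\<in>basis N \<Gamma>. relabel N f x \<in> basis N \<Delta> \<and> \<psi> (relabel N f x) = relabel M f (\<psi> x))) \<and>
     (\<forall>\<Gamma> I. connected_graph \<Gamma> \<and> tube_partition \<Gamma> I \<longrightarrow>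
        (\<forall>x\<in>basis N (contract \<Gamma> I). \<forall>s\<in>(\<Pi>\<^sub>E G\<in>I. basis P (induced \<Gamma> G)).
           bact N \<Gamma> I x s \<in> basis N \<Gamma> \<and> \<psi> (bact N \<Gamma> I x s) = bact M \<Gamma> I (\<psi> x) s))"

context
  fixes P :: "('a, 'q) bcontractad" and N :: "('a, 'x, 'q) bmodule" and M :: "('a, 'y, 'q) bmodule"
    and \<psi> :: "'x \<Rightarrow> 'y"
  assumes emb: "bmodule_embedding P N M \<psi>"
begin

lemma
  assumes "connected_graph \<Gamma>" "connected_graph \<Delta>" "graph_iso f \<Gamma> \<Delta>"
    and m: "m \<in> space (linearize N) \<Gamma>"
  shows transport_linearize_closed: "transport (linearize N) f m \<in> space (linearize N) \<Delta>"
    and push_transport: "push \<psi> (transport (linearize N) f m) = transport (linearize M) f (push \<psi> m)"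
proof -
  have *: "relabel N f x \<in> basis N \<Delta> \<and> \<psi> (relabel N f x) = relabel M f (\<psi> x)"
    if "x \<in> Poly_Mapping.keys m" for x
    using emb assms that by (auto simp: bmodule_embedding_def space_linearize)
  then show "transport (linearize N) f m \<in> space (linearize N) \<Delta>"
    unfolding space_linearize transport_linearize using keys_push by fast
  show "push \<psi> (transport (linearize N) f m) = transport (linearize M) f (push \<psi> m)"
    unfolding transport_linearize push_push by (rule push_cong) (use * in blast)
qed

lemma
  assumes "connected_graph \<Gamma>" "tube_partition \<Gamma> I"
    and m: "m \<in> space (linearize N) (contract \<Gamma> I)"
    and p: "\<forall>G\<in>I. p G \<in> space (linearize P) (induced \<Gamma> G)"
  shows act_linearize_closed: "act (linearize N) \<Gamma> I m p \<in> space (linearize N) \<Gamma>"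
    and push_act: "push \<psi> (act (linearize N) \<Gamma> I m p) = act (linearize M) \<Gamma> I (push \<psi> m) p"
proof -
  have *: "bact N \<Gamma> I x s \<in> basis N \<Gamma> \<and> \<psi> (bact N \<Gamma> I x s) = bact M \<Gamma> I (\<psi> x) s"
    if "x \<in> Poly_Mapping.keys m" "s \<in> (\<Pi>\<^sub>E G\<in>I. Poly_Mapping.keys (p G))" for x s
  proof -
    \<comment> \<open>The keys of each \<open>p G\<close> are basis elements, so every choice of
      keys is a family to which \<open>emb\<close> applies.\<close>
    have "s \<in> (\<Pi>\<^sub>E G\<in>I. basis P (induced \<Gamma> G))"
      using that(2) p by (fastforce simp: space_linearize PiE_iff)
    then show ?thesis
      using emb assms that(1) by (auto simp: bmodule_embedding_def space_linearize)
  qed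
  have act: "act (linearize N) \<Gamma> I m p =
      (\<Sum>x\<in>Poly_Mapping.keys m. \<Sum>s\<in>(\<Pi>\<^sub>E G\<in>I. Poly_Mapping.keys (p G)).
        Poly_Mapping.single (bact N \<Gamma> I x s)
          (Poly_Mapping.lookup m x * (\<Prod>G\<in>I. Poly_Mapping.lookup (p G) (s G))))"
    by (simp add: linearize_def)
  have "Poly_Mapping.keys (act (linearize N) \<Gamma> I m p) \<subseteq>
      (\<Union>x\<in>Poly_Mapping.keys m. \<Union>s\<in>(\<Pi>\<^sub>E G\<in>I. Poly_Mapping.keys (p G)). {bact N \<Gamma> I x s})"
    unfolding act
    by (intro order_trans[OF keys_sum_subset] UN_mono subset_refl) auto
  then show "act (linearize N) \<Gamma> I m p \<in> space (linearize N) \<Gamma>"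
    unfolding space_linearize using * by fast
  show "push \<psi> (act (linearize N) \<Gamma> I m p) = act (linearize M) \<Gamma> I (push \<psi> m) p"
    unfolding act push_def[of \<psi> m] by (simp add: act_linearize_sum act_linearize_single push_sum *)
qed

end

text \<open>If the images of two bases partition the basis of \<open>M\<close>, disjointness makes
  the sum of the two linear extensions injective and covering makes it surjective. This sum map has
  a formula without case distinctions; its morphism laws are checked first and it is inverted
  afterwards.\<close>

lemma rmodule_isomorphic_complementary_embeddings:
  fixes P :: "('a, 'q) bcontractad" and M :: "('a, 'y, 'q) bmodule"
  assumes emb1: "bmodule_embedding P N1 M \<psi>1" and emb2: "bmodule_embedding P N2 M \<psi>2"
    and Un: "\<And>\<Gamma>. connected_graph \<Gamma> \<Longrightarrow> \<psi>1 ` basis N1 \<Gamma> \<union> \<psi>2 ` basis N2 \<Gamma> = basis M \<Gamma>"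
    and Int: "\<And>\<Gamma>. connected_graph \<Gamma> \<Longrightarrow> \<psi>1 ` basis N1 \<Gamma> \<inter> \<psi>2 ` basis N2 \<Gamma> = {}"
  shows "rmodule_isomorphic (linearize P) (linearize M :: ('a, 'k::field, _, _) rmodule)
    (direct_sum (linearize N1) (linearize N2))"
proof -
  define N :: "('a, 'k, _, _) rmodule" where "N = direct_sum (linearize N1) (linearize N2)"
  have space_N: "space N \<Gamma> = space (linearize N1) \<Gamma> \<times> space (linearize N2) \<Gamma>" for \<Gamma>
    by (simp add: N_def direct_sum_def)
  have ops: "scale N c (a, b) = (free_scale c a, free_scale c b)"
    "transport N f (a, b) = (transport (linearize N1) f a, transport (linearize N2) f b)"
    "act N \<Gamma> I (a, b) p = (act (linearize N1) \<Gamma> I a p, act (linearize N2) \<Gamma> I b p)" for c f \<Gamma> I a b p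
    by (simp_all add: N_def direct_sum_def scale_linearize)
  define \<Psi> :: "_ \<Rightarrow> _ \<Rightarrow>\<^sub>0 'k" where "\<Psi> = (\<lambda>(a, b). push \<psi>1 a + push \<psi>2 b)"
  have "bij_betw \<Psi> (space N \<Gamma>) (space (linearize M) \<Gamma>)" if \<Gamma>: "connected_graph \<Gamma>" for \<Gamma>
  proof -
    let ?B1 = "basis N1 \<Gamma>" and ?B2 = "basis N2 \<Gamma>"
    have inj: "inj_on \<psi>1 ?B1" "inj_on \<psi>2 ?B2"
      using emb1 emb2 \<Gamma> by (simp_all add: bmodule_embedding_def)
    \<comment> \<open>Only \<open>a\<close> contributes at \<open>\<psi>1 x\<close>, the images of
      the two bases being disjoint, so \<open>a\<close> can be read off from the sum.\<close>
    have lookup1: "Poly_Mapping.lookup (\<Psi> (a, b)) (\<psi>1 x) = Poly_Mapping.lookup a x"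
      if "Poly_Mapping.keys a \<subseteq> ?B1" "Poly_Mapping.keys b \<subseteq> ?B2" "x \<in> ?B1" for a b x
    proof -
      have "\<psi>1 x \<notin> \<psi>2 ` Poly_Mapping.keys b" using Int[OF \<Gamma>] that by blast
      then show ?thesis
        using lookup_push[OF inj(1) that(1,3)] by (simp add: \<Psi>_def lookup_add lookup_push_eq_0)
    qed
    have lookup2: "Poly_Mapping.lookup (\<Psi> (a, b)) (\<psi>2 x) = Poly_Mapping.lookup b x"
      if "Poly_Mapping.keys a \<subseteq> ?B1" "Poly_Mapping.keys b \<subseteq> ?B2" "x \<in> ?B2" for a b x
    proof -
      have "\<psi>2 x \<notin> \<psi>1 ` Poly_Mapping.keys a" using Int[OF \<Gamma>] that by blast
      then show ?thesis
        using lookup_push[OF inj(2) that(2,3)] by (simp add: \<Psi>_def lookup_add lookup_push_eq_0)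
    qed
    have "inj_on \<Psi> (space N \<Gamma>)"
    proof (rule inj_onI)
      fix x y assume xy: "x \<in> space N \<Gamma>" "y \<in> space N \<Gamma>" and eq: "\<Psi> x = \<Psi> y"
      obtain a b a' b' where ab: "x = (a, b)" "y = (a', b')" by (cases x, cases y)
      have k: "Poly_Mapping.keys a \<subseteq> ?B1" "Poly_Mapping.keys b \<subseteq> ?B2"
        "Poly_Mapping.keys a' \<subseteq> ?B1" "Poly_Mapping.keys b' \<subseteq> ?B2"
        using xy by (simp_all add: ab space_N space_linearize)
      have "a = a'"
      proof (rule poly_mapping_eqI_on[OF k(1,3)])
        fix z assume z: "z \<in> ?B1"
        show "Poly_Mapping.lookup a z = Poly_Mapping.lookup a' z"
          using eq unfolding ab by (metis lookup1[OF k(1,2) z] lookup1[OF k(3,4) z])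
      qed
      moreover have "b = b'"
      proof (rule poly_mapping_eqI_on[OF k(2,4)])
        fix z assume z: "z \<in> ?B2"
        show "Poly_Mapping.lookup b z = Poly_Mapping.lookup b' z"
          using eq unfolding ab by (metis lookup2[OF k(1,2) z] lookup2[OF k(3,4) z])
      qed
      ultimately show "x = y" by (simp add: ab)
    qed
    moreover have "\<Psi> x \<in> space (linearize M) \<Gamma>" if x: "x \<in> space N \<Gamma>" for x
    proof -
      obtain a b where ab: "x = (a, b)" by (cases x)
      have "Poly_Mapping.keys a \<subseteq> ?B1" "Poly_Mapping.keys b \<subseteq> ?B2"
        using x by (simp_all add: ab space_N space_linearize)
      then have "\<psi>1 ` Poly_Mapping.keys a \<union> \<psi>2 ` Poly_Mapping.keys b \<subseteq> basis M \<Gamma>"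
        using Un[OF \<Gamma>] by blast
      moreover have "Poly_Mapping.keys (\<Psi> x) \<subseteq> \<psi>1 ` Poly_Mapping.keys a \<union> \<psi>2 ` Poly_Mapping.keys b"
        unfolding \<Psi>_def ab prod.case
        by (intro order_trans[OF Poly_Mapping.keys_add] Un_mono keys_push)
      ultimately show ?thesis unfolding space_linearize by blast
    qed
    moreover have "m \<in> \<Psi> ` space N \<Gamma>" if m: "m \<in> space (linearize M) \<Gamma>" for m
    proof -
      have "Poly_Mapping.keys m \<subseteq> \<psi>1 ` ?B1 \<union> \<psi>2 ` ?B2"
        using m Un[OF \<Gamma>] by (simp add: space_linearize)
      then obtain a b where "Poly_Mapping.keys a \<subseteq> ?B1" "Poly_Mapping.keys b \<subseteq> ?B2"
        and "push \<psi>1 a + push \<psi>2 b = m"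
        by (rule push_pair_surj)
      then have "(a, b) \<in> space N \<Gamma>" "m = \<Psi> (a, b)"
        by (simp_all add: space_N space_linearize \<Psi>_def)
      then show ?thesis by (rule image_eqI[rotated])
    qed
    ultimately show ?thesis
      by (intro bij_betw_imageI subset_antisym image_subsetI subsetI)
  qed
  note bij = this
  have "is_rmodule_iso (linearize P) N (linearize M) (\<lambda>_. \<Psi>)"
    unfolding is_rmodule_iso_def
  proof (intro conjI allI impI ballI; (elim conjE)?)
    fix \<Gamma> :: "'a vgraph" and x y assume "connected_graph \<Gamma>"
    then show "bij_betw \<Psi> (space N \<Gamma>) (space (linearize M) \<Gamma>)" by (rule bij)
    show "\<Psi> (x + y) = \<Psi> x + \<Psi> y"
      by (cases x, cases y) (simp add: \<Psi>_def push_add add_ac)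
    show "\<Psi> (scale N c x) = scale (linearize M) c (\<Psi> x)" for c
      by (cases x) (simp add: \<Psi>_def ops scale_linearize push_free_scale free_scale_add)
  next
    fix \<Gamma> \<Delta> :: "'a vgraph" and f x
    assume *: "connected_graph \<Gamma>" "connected_graph \<Delta>" "graph_iso f \<Gamma> \<Delta>" "x \<in> space N \<Gamma>"
    obtain a b where ab: "x = (a, b)" by (cases x)
    then have "a \<in> space (linearize N1) \<Gamma>" "b \<in> space (linearize N2) \<Gamma>"
      using *(4) by (simp_all add: space_N)
    note push_transport[OF emb1 *(1-3) this(1)] push_transport[OF emb2 *(1-3) this(2)]
    then show "\<Psi> (transport N f x) = transport (linearize M) f (\<Psi> x)"
      by (simp add: ab \<Psi>_def ops transport_linearize push_add)
  next
    fix \<Gamma> :: "'a vgraph" and I x and p :: "'a vert set \<Rightarrow> 'q \<Rightarrow>\<^sub>0 'k"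
    assume *: "x \<in> space N (contract \<Gamma> I)" "\<forall>G\<in>I. p G \<in> space (linearize P) (induced \<Gamma> G)"
      "connected_graph \<Gamma>" "tube_partition \<Gamma> I"
    obtain a b where ab: "x = (a, b)" by (cases x)
    then have "a \<in> space (linearize N1) (contract \<Gamma> I)" "b \<in> space (linearize N2) (contract \<Gamma> I)"
      using *(1) by (simp_all add: space_N)
    note push_act[OF emb1 *(3,4) this(1) *(2)] push_act[OF emb2 *(3,4) this(2) *(2)]
    then show "\<Psi> (act N \<Gamma> I x p) = act (linearize M) \<Gamma> I (\<Psi> x) p"
      by (simp add: ab \<Psi>_def ops act_linearize_add)
  qed
  then have "is_rmodule_iso (linearize P) (linearize M) N
      (\<lambda>\<Gamma>. inv_into (space N \<Gamma>) \<Psi>)"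
  proof (rule is_rmodule_iso_inv_into)
    fix \<Gamma> x y assume "x \<in> space N \<Gamma>" "y \<in> space N \<Gamma>"
    then show "x + y \<in> space N \<Gamma>"
      by (auto simp: space_N space_linearize dest!: subsetD[OF Poly_Mapping.keys_add])
  next
    fix \<Gamma> c x assume "x \<in> space N \<Gamma>"
    then show "scale N c x \<in> space N \<Gamma>"
      by (auto simp: space_N space_linearize ops dest!: subsetD[OF keys_free_scale])
  next
    fix \<Gamma> \<Delta> :: "'a vgraph" and f x
    assume *: "connected_graph \<Gamma>" "connected_graph \<Delta>" "graph_iso f \<Gamma> \<Delta>" "x \<in> space N \<Gamma>"
    obtain a b where ab: "x = (a, b)" by (cases x)
    then have "a \<in> space (linearize N1) \<Gamma>" "b \<in> space (linearize N2) \<Gamma>"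
      using *(4) by (simp_all add: space_N)
    note transport_linearize_closed[OF emb1 *(1-3) this(1)]
      transport_linearize_closed[OF emb2 *(1-3) this(2)]
    then show "transport N f x \<in> space N \<Delta>" by (simp add: ab space_N ops)
  next
    fix \<Gamma> :: "'a vgraph" and I x and p :: "'a vert set \<Rightarrow> 'q \<Rightarrow>\<^sub>0 'k"
    assume *: "connected_graph \<Gamma>" "tube_partition \<Gamma> I" "x \<in> space N (contract \<Gamma> I)"
      "\<forall>G\<in>I. p G \<in> space (linearize P) (induced \<Gamma> G)"
    obtain a b where ab: "x = (a, b)" by (cases x)
    then have "a \<in> space (linearize N1) (contract \<Gamma> I)" "b \<in> space (linearize N2) (contract \<Gamma> I)"
      using *(3) by (simp_all add: space_N)
    note act_linearize_closed[OF emb1 *(1,2) this(1) *(4)]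
      act_linearize_closed[OF emb2 *(1,2) this(2) *(4)]
    then show "act N \<Gamma> I x p \<in> space N \<Gamma>" by (simp add: ab space_N ops)
  qed
  then show ?thesis unfolding rmodule_isomorphic_def N_def by blast
qed


section \<open>The embeddings\<close>

lemma plan_list_relabel:
  assumes f: "graph_iso f \<Gamma> \<Delta>" and xs: "plan_list (edges \<Gamma>) xs" "set xs \<subseteq> verts \<Gamma>"
  shows "plan_list (edges \<Delta>) (map f xs)"
  using xs(1)
proof (rule plan_list_map)
  fix u v assume "u \<in> set xs" "v \<in> set xs" "{u, v} \<in> edges \<Gamma>"
  then show "{f u, f v} \<in> edges \<Delta>" using f xs(2) unfolding graph_iso_def by blast
qed

lemma ordering_relabel:
  assumes "graph_iso f \<Gamma> \<Delta>" "xs \<in> orderings \<Gamma>"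
  shows "map f xs \<in> orderings \<Delta>"
  using assms by (simp add: orderings_def graph_iso_def bij_betw_def distinct_map)

text \<open>The map is the identity, so the content is closure: relabelling and substitution keep an
  admissible representative admissible.\<close>

lemma CycEq_embedding: "bmodule_embedding PlanEq_basis CycEq_basis CycPerm_basis (\<lambda>x. x)"
proof -
  \<comment> \<open>An admissible representative determines its cyclic ordering, so closure can be
    checked on that one list.\<close>
  have basis: "c \<in> basis CycEq_basis \<Gamma> \<longleftrightarrow> (\<exists>xs. xs \<in> plan_orderings \<Gamma> \<and> c = cyc xs)"
    if "connected_graph \<Gamma>" for \<Gamma> :: "'a vgraph" and c
  proof -
    have simple: "simple_graph \<Gamma>" using that by (simp add: connected_graph_def)
    have "cyc xs \<in> cyclic_orderings \<Gamma>" if "xs \<in> plan_orderings \<Gamma>" for xs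
      using that plan_orderings_iff[OF simple] by (simp add: cyclic_orderings_def)
    moreover have "c = cyc xs" if "c \<in> cyclic_orderings \<Gamma>" "xs \<in> c" for xs
      using that(1) by (rule cyclic_orderings_cases) (metis that(2) cyc_eqI)
    ultimately show ?thesis
      unfolding CycEq_basis_def using cyc_self by simp blast
  qed
  show ?thesis
    unfolding bmodule_embedding_def
  proof (intro conjI allI impI ballI; (elim conjE)?)
    fix \<Gamma> \<Delta> :: "'a vgraph" and f c
    assume \<Gamma>: "connected_graph \<Gamma>" and \<Delta>: "connected_graph \<Delta>" and f: "graph_iso f \<Gamma> \<Delta>"
      and c: "c \<in> basis CycEq_basis \<Gamma>"
    obtain xs where xs: "xs \<in> plan_orderings \<Gamma>" "c = cyc xs" using c basis[OF \<Gamma>] by blast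
    have simple: "simple_graph \<Gamma>" "simple_graph \<Delta>"
      using \<Gamma> \<Delta> by (simp_all add: connected_graph_def)
    have "xs \<in> orderings \<Gamma>" "plan_list (edges \<Gamma>) xs"
      using xs(1) plan_orderings_iff[OF simple(1)] by blast+
    moreover have "set xs \<subseteq> verts \<Gamma>" using calculation by (simp add: orderings_def)
    ultimately have "map f xs \<in> plan_orderings \<Delta>"
      using ordering_relabel[OF f] plan_list_relabel[OF f] plan_orderings_iff[OF simple(2)] by simp
    then show "relabel CycEq_basis f c \<in> basis CycEq_basis \<Delta>"
      unfolding basis[OF \<Delta>] by (auto simp: CycEq_basis_def CycPerm_basis_def xs(2) map_cyc)
  next
    fix \<Gamma> :: "'a vgraph" and I c p
    assume \<Gamma>: "connected_graph \<Gamma>" and I: "tube_partition \<Gamma> I"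
      and c: "c \<in> basis CycEq_basis (contract \<Gamma> I)"
      and p: "p \<in> (\<Pi>\<^sub>E G\<in>I. basis PlanEq_basis (induced \<Gamma> G))"
    interpret graph_partition \<Gamma> I by (rule graph_partition_of_tubes[OF \<Gamma> I])
    obtain xs where xs: "xs \<in> plan_orderings (contract \<Gamma> I)" "c = cyc xs"
      using c basis[OF connected_contract[OF \<Gamma> I]] by blast
    have ord: "xs \<in> orderings (contract \<Gamma> I)" "plan_list (edges (contract \<Gamma> I)) xs"
      using xs(1) plan_orderings_iff[OF simple_graph_contract] by blast+
    have p: "block_orderings p"
      using p mem_PiE_plan_orderings_iff by (simp add: PlanEq_basis_def)
    have "subst_list xs p \<in> orderings \<Gamma>"
      by (rule subst_list_ordering[OF ord(1)]) (simp add: block_orderingsD[OF p])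
    moreover have "plan_list (edges \<Gamma>) (subst_list xs p)"
      using ord by (intro plan_list_subst_list_blocks)
        (simp_all add: block_orderingsD[OF p] orderings_def verts_contract)
    ultimately have "subst_list xs p \<in> plan_orderings \<Gamma>" using plan_orderings_iff[OF simple] by blast
    then show "bact CycEq_basis \<Gamma> I c p \<in> basis CycEq_basis \<Gamma>"
      unfolding basis[OF \<Gamma>] by (auto simp: CycEq_basis_def CycPerm_basis_def xs(2) subst_cyc_cyc)
  qed (simp_all add: CycEq_basis_def CycPerm_basis_def)
qed

section \<open>Decompositions under graph isomorphisms\<close>

context graph_partition
begin

context
  fixes \<Delta> :: "'a vgraph" and f
  assumes \<Delta>: "simple_graph \<Delta>" and f: "graph_iso f \<Gamma> \<Delta>"
begin

lemma inj_on_relabel: "inj_on f (verts \<Gamma>)"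
  using f by (simp add: graph_iso_def bij_betw_def)

lemma inj_on_image_blocks: "inj_on ((`) f) I"
  using inj_on_image_eq_iff[OF inj_on_relabel] block_subset by (simp add: inj_on_def)

lemma graph_partition_relabel: "graph_partition \<Delta> ((`) f ` I)"
proof
  have "f ` verts \<Gamma> = verts \<Delta>" using f by (simp add: graph_iso_def bij_betw_def)
  \<comment> \<open>\<open>partition_on_inj_image\<close> removes the empty set from the family of
    images; no block has an empty image.\<close>
  moreover have "(`) f ` I - {{}} = (`) f ` I" using block_nonempty by auto
  ultimately show "partition_on (verts \<Delta>) ((`) f ` I)"
    using partition_on_inj_image[OF part inj_on_relabel] by simp
qed (rule \<Delta>)

lemma graph_iso_contract_relabel:
  "graph_iso (on_blocks ((`) f)) (contract \<Gamma> I) (contract \<Delta> ((`) f ` I))"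
proof (rule graph_iso_on_blocks[OF graph_partition_axioms graph_partition_relabel])
  show "bij_betw ((`) f) I ((`) f ` I)" using inj_on_image_blocks by (rule inj_on_imp_bij_betw)
  fix G H assume "G \<in> I" "H \<in> I"
  then have "G \<subseteq> verts \<Gamma>" "H \<subseteq> verts \<Gamma>" by (simp_all add: block_subset)
  then have "{u, v} \<in> edges \<Gamma> \<longleftrightarrow> {f u, f v} \<in> edges \<Delta>" if "u \<in> G" "v \<in> H" for u v
    using f that by (auto simp: graph_iso_def)
  then show "(\<exists>u\<in>G. \<exists>v\<in>H. {u, v} \<in> edges \<Gamma>) \<longleftrightarrow> (\<exists>u\<in>f ` G. \<exists>v\<in>f ` H. {u, v} \<in> edges \<Delta>)"
    by simp
qed

lemma inv_into_image_block: "G \<in> I \<Longrightarrow> inv_into I ((`) f) (f ` G) = G"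
  using inj_on_image_blocks by simp

text \<open>The family over the image partition finds the original block by \<open>inv_into\<close>,
  which is exact because taking images is injective on blocks. Through \<open>map_cyc\<close> and
  \<open>subst_cyc_cyc\<close> this becomes compatibility with relabelling.\<close>

lemma subst_list_relabel:
  assumes "set zs \<subseteq> blk ` I"
  shows "subst_list (map (on_blocks ((`) f)) zs) (\<lambda>H\<in>(`) f ` I. map f (s (inv_into I ((`) f) H)))
    = map f (subst_list zs s)"
proof -
  have "(\<lambda>H\<in>(`) f ` I. map f (s (inv_into I ((`) f) H))) (unblk (on_blocks ((`) f) v)) = map f (s (unblk v))"
    if "v \<in> set zs" for v
  proof -
    obtain G where G: "G \<in> I" "v = blk G" using \<open>v \<in> set zs\<close> assms by blast
    then show ?thesis
      by (simp add: on_blocks_def unblk_blk finite_block inv_into_image_block)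
  qed
  then show ?thesis
    unfolding subst_list_def map_concat map_map by (intro arg_cong[where f = concat]) simp
qed

lemma block_orderings_relabel:
  assumes s: "block_orderings s"
  shows "graph_partition.block_orderings \<Delta> ((`) f ` I)
    (\<lambda>H\<in>(`) f ` I. map f (s (inv_into I ((`) f) H)))"
proof -
  interpret \<Delta>: graph_partition \<Delta> "(`) f ` I" by (rule graph_partition_relabel)
  have "distinct (map f (s G)) \<and> set (map f (s G)) = f ` G \<and> plan_list (edges \<Delta>) (map f (s G))"
    if G: "G \<in> I" for G
  proof -
    have "inj_on f G" using inj_on_relabel block_subset[OF G] by (rule inj_on_subset)
    then show ?thesis
      using block_orderingsD[OF s G] block_subset[OF G] plan_list_relabel[OF f] by (simp add: distinct_map)
  qed
  then show ?thesis
    unfolding \<Delta>.block_orderings_def by (simp add: inv_into_image_block)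
qed

end

section \<open>Iterated contractions and associativity of substitution\<close>

context
  fixes J :: "'a vert set set"
  assumes J: "partition_on (verts (contract \<Gamma> I)) J"
begin

lemma graph_partition_iterated: "graph_partition (contract \<Gamma> I) J"
  by unfold_locales (rule simple_graph_contract J)+

lemma iterated_block_subset: "C \<in> J \<Longrightarrow> C \<subseteq> blk ` I"
  using partition_onD1[OF J] by (auto simp: verts_contract)

lemma flatten_disjoint:
  assumes "C \<in> J" "D \<in> J" "x \<in> flatten C" "x \<in> flatten D"
  shows "C = D"
proof -
  obtain G where G: "G \<in> I" "x \<in> G" "blk G \<in> C"
    using assms(1,3) iterated_block_subset[OF assms(1)] unfolding flatten_def by force
  then have "blk G \<in> D" using mem_flatten_iff[OF iterated_block_subset[OF assms(2)]] assms(4) by blast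
  then show ?thesis
    using graph_partition.block_unique[OF graph_partition_iterated assms(1,2) G(3)] by blast
qed

lemma flatten_nonempty:
  assumes "C \<in> J"
  shows "flatten C \<noteq> {}"
proof -
  obtain v where "v \<in> C"
    using graph_partition.block_nonempty[OF graph_partition_iterated assms] by blast
  moreover then obtain G where "G \<in> I" "v = blk G" using iterated_block_subset[OF assms] by blast
  ultimately show ?thesis using block_nonempty unfolding flatten_def by fastforce
qed

text \<open>Flattened blocks are disjoint and nonempty, so they determine the blocks they come from;
  the action of \<open>composite\<close> relies on this through
  \<open>inv_into J flatten\<close>.\<close>

lemma inj_on_flatten: "inj_on flatten J"
  using flatten_disjoint flatten_nonempty by (intro inj_onI) (metis ex_in_conv)

lemma graph_partition_flatten: "graph_partition \<Gamma> (flatten ` J)"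
proof
  show "partition_on (verts \<Gamma>) (flatten ` J)"
  proof (rule partition_onI)
    have "\<Union>(flatten ` J) = flatten (\<Union>J)" unfolding flatten_def by blast
    then show "\<Union>(flatten ` J) = verts \<Gamma>"
      using partition_onD1[OF J] flatten_verts_contract by simp
    show "disjnt p q" if pq: "p \<in> flatten ` J" "q \<in> flatten ` J" "p \<noteq> q" for p q
      using pq flatten_disjoint unfolding disjnt_def by blast
    show "{} \<notin> flatten ` J" using flatten_nonempty by blast
  qed
qed (rule simple)

text \<open>An edge of \<Gamma> between different flattened blocks has its ends in different blocks
  of \<open>I\<close> and so survives the first contraction; conversely, each edge of
  \<open>contract \<Gamma> I\<close> comes from one of \<Gamma>.\<close>

lemma graph_iso_contract_flatten:
  "graph_iso (on_blocks flatten) (contract (contract \<Gamma> I) J) (contract \<Gamma> (flatten ` J))"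
proof (rule graph_iso_on_blocks[OF graph_partition_iterated graph_partition_flatten])
  show "bij_betw flatten J (flatten ` J)" using inj_on_flatten by (rule inj_on_imp_bij_betw)
  fix C D assume C: "C \<in> J" and D: "D \<in> J" and "C \<noteq> D"
  show "(\<exists>u\<in>C. \<exists>v\<in>D. {u, v} \<in> edges (contract \<Gamma> I)) \<longleftrightarrow>
      (\<exists>u\<in>flatten C. \<exists>v\<in>flatten D. {u, v} \<in> edges \<Gamma>)"
  proof
    assume "\<exists>u\<in>C. \<exists>v\<in>D. {u, v} \<in> edges (contract \<Gamma> I)"
    then obtain u v where uv: "u \<in> C" "v \<in> D" "{u, v} \<in> edges (contract \<Gamma> I)" by blast
    then obtain G H where GH: "G \<in> I" "H \<in> I" "u = blk G" "v = blk H"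
      using iterated_block_subset[OF C] iterated_block_subset[OF D] by blast
    then obtain a b where "a \<in> G" "b \<in> H" "{a, b} \<in> edges \<Gamma>"
      using uv(3) edges_contract_iff[OF GH(1,2)] by blast
    moreover then have "a \<in> flatten C" "b \<in> flatten D"
      using mem_flatten_iff[OF iterated_block_subset[OF C] GH(1)] mem_flatten_iff[OF iterated_block_subset[OF D] GH(2)] uv GH(3,4)
      by simp_all
    ultimately show "\<exists>u\<in>flatten C. \<exists>v\<in>flatten D. {u, v} \<in> edges \<Gamma>" by blast
  next
    assume "\<exists>u\<in>flatten C. \<exists>v\<in>flatten D. {u, v} \<in> edges \<Gamma>"
    then obtain a b where ab: "a \<in> flatten C" "b \<in> flatten D" "{a, b} \<in> edges \<Gamma>" by blast
    have "a \<in> \<Union>I" "b \<in> \<Union>I"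
      using simple_graph_edgeD[OF simple ab(3)] partition_onD1[OF part] by simp_all
    then obtain G H where GH: "G \<in> I" "H \<in> I" "a \<in> G" "b \<in> H" by blast
    have blk: "blk G \<in> C" "blk H \<in> D"
      using mem_flatten_iff[OF iterated_block_subset[OF C] GH(1,3)] mem_flatten_iff[OF iterated_block_subset[OF D] GH(2,4)] ab
      by simp_all
    then have "G \<noteq> H"
      using graph_partition.block_unique[OF graph_partition_iterated C D] \<open>C \<noteq> D\<close> by blast
    then have "{blk G, blk H} \<in> edges (contract \<Gamma> I)"
      using edges_contract_iff[OF GH(1,2)] ab(3) GH(3,4) by blast
    then show "\<exists>u\<in>C. \<exists>v\<in>D. {u, v} \<in> edges (contract \<Gamma> I)" using blk by blast
  qed
qed

lemma inv_into_flatten: "C \<in> J \<Longrightarrow> inv_into J flatten (flatten C) = C"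
  using inj_on_flatten by simp

lemma subst_list_restrict:
  assumes "C \<in> J" "set xs = C"
  shows "subst_list xs (restrict p {G \<in> I. blk G \<in> C}) = subst_list xs p"
proof (rule subst_list_cong)
  fix v assume "v \<in> set xs"
  then obtain G where "G \<in> I" "v = blk G" "v \<in> C" using assms iterated_block_subset by blast
  then show "restrict p {G \<in> I. blk G \<in> C} (unblk v) = p (unblk v)" by simp
qed

text \<open>Here \<open>composed\<close> is the family that the action of \<open>composite\<close>
  attaches to the flattened partition, with the composition of \<open>PlanEq_basis\<close> unfolded
  to \<open>subst_list\<close>.\<close>

context
  fixes s p :: "'a vert set \<Rightarrow> 'a vert list" and composed
  assumes s: "graph_partition.block_orderings (contract \<Gamma> I) J s" and p: "block_orderings p"
  defines "composed \<equiv> \<lambda>H\<in>flatten ` J. let C = inv_into J flatten H; I' = {G \<in> I. blk G \<in> C}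
    in subst_list (s C) (restrict p I')"
begin

lemma composed_flatten: "C \<in> J \<Longrightarrow> composed (flatten C) = subst_list (s C) p"
  using graph_partition.block_orderingsD(2)[OF graph_partition_iterated s]
  by (simp add: composed_def inv_into_flatten subst_list_restrict)

lemma block_orderings_composed: "graph_partition.block_orderings \<Gamma> (flatten ` J) composed"
proof -
  interpret F: graph_partition \<Gamma> "flatten ` J" by (rule graph_partition_flatten)
  have "distinct (subst_list (s C) p) \<and> set (subst_list (s C) p) = flatten C \<and>
      plan_list (edges \<Gamma>) (subst_list (s C) p)" if C: "C \<in> J" for C
  proof -
    note sC = graph_partition.block_orderingsD[OF graph_partition_iterated s C]
    have "plan_list (edges \<Gamma>) (subst_list (s C) p)"
      using iterated_block_subset[OF C] sC(2,3) by (intro plan_list_subst_list_blocks) (simp_all add: block_orderingsD[OF p])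
    then show ?thesis
      using subst_list_blocks[OF iterated_block_subset[OF C] sC(1,2)] block_orderingsD[OF p] by blast
  qed
  then show ?thesis unfolding F.block_orderings_def by (simp add: composed_flatten)
qed

text \<open>The word of \<open>composed\<close> over \<open>flatten C\<close> is \<open>s C\<close>
  with \<open>p\<close> substituted, and substitution distributes over concatenation. This
  associativity is the compatibility with the action, on lists.\<close>

lemma subst_list_subst_list:
  assumes "set zs \<subseteq> blk ` J"
  shows "subst_list (map (on_blocks flatten) zs) composed = subst_list (subst_list zs s) p"
proof -
  have "composed (unblk (on_blocks flatten v)) = subst_list (s (unblk v)) p" if "v \<in> set zs" for v
  proof -
    obtain C where C: "C \<in> J" "v = blk C" using \<open>v \<in> set zs\<close> assms by blast
    have "finite (flatten C)"
      using graph_partition.finite_block[OF graph_partition_flatten] C(1) by blast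
    moreover have "unblk (blk C) = C"
      by (rule graph_partition.unblk_blk_block[OF graph_partition_iterated C(1)])
    ultimately show ?thesis by (simp add: on_blocks_def unblk_blk composed_flatten C)
  qed
  then have "subst_list (map (on_blocks flatten) zs) composed = concat (map (\<lambda>v. subst_list (s (unblk v)) p) zs)"
    unfolding subst_list_def map_map by (intro arg_cong[where f = concat]) simp
  also have "\<dots> = subst_list (subst_list zs s) p"
    by (induction zs) (simp_all add: subst_list_def)
  finally show ?thesis .
qed

end
end
end

text \<open>The clauses on relabelling and action are checked on a list \<open>zs\<close>
  representing \<open>c\<close>: \<open>map_cyc\<close> and \<open>subst_cyc_cyc\<close> reduce them
  to \<open>subst_list_relabel\<close> and \<open>subst_list_subst_list\<close>.\<close>

lemma CycHam_embedding:
  "bmodule_embedding PlanEq_basis (composite CycHam_basis PlanEq_basis) CycPerm_basis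
    (\<lambda>(I, c, s). subst_cyc c s)"
  unfolding bmodule_embedding_def
proof (intro conjI allI impI)
  fix \<Gamma> :: "'a vgraph" assume "connected_graph \<Gamma>"
  then show "inj_on (\<lambda>(I, c, s). subst_cyc c s) (basis (composite CycHam_basis PlanEq_basis) \<Gamma>)"
    by (rule decomposition_unique)
next
  fix \<Gamma> \<Delta> :: "'a vgraph" and f
  let ?N = "composite CycHam_basis PlanEq_basis :: ('a, _, _) bmodule"
  let ?\<psi> = "\<lambda>(I :: 'a vert set set, c, s). subst_cyc c s"
  assume "connected_graph \<Gamma> \<and> connected_graph \<Delta> \<and> graph_iso f \<Gamma> \<Delta>"
  then have \<Gamma>: "connected_graph \<Gamma>" and \<Delta>: "connected_graph \<Delta>" and f: "graph_iso f \<Gamma> \<Delta>" by simp_all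
  have simple_\<Delta>: "simple_graph \<Delta>" using \<Delta> by (simp add: connected_graph_def)
  show "\<forall>x\<in>basis ?N \<Gamma>. relabel ?N f x \<in> basis ?N \<Delta> \<and> ?\<psi> (relabel ?N f x) = relabel CycPerm_basis f (?\<psi> x)"
  proof
    fix x assume x: "x \<in> basis ?N \<Gamma>"
    obtain I c s where Ics: "x = (I, c, s)" by (cases x)
    note x = x[unfolded Ics]
    obtain zs where zs: "graph_partition \<Gamma> I" "zs \<in> orderings (contract \<Gamma> I)" "c = cyc zs"
      "graph_partition.block_orderings \<Gamma> I s"
      using composite_cases[OF \<Gamma> x] by metis
    from zs(1) interpret graph_partition \<Gamma> I .
    let ?I = "(`) f ` I" and ?c = "map (on_blocks ((`) f)) ` c"
      and ?s = "\<lambda>H\<in>(`) f ` I. map f (s (inv_into I ((`) f) H))"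
    have rel: "relabel ?N f x = (?I, ?c, ?s)"
      by (simp add: Ics composite_def PlanEq_basis_def CycHam_basis_def)
    have "c \<in> basis CycHam_basis (contract \<Gamma> I)" using x by (simp add: mem_composite_iff[OF \<Gamma>])
    then have "?c \<in> basis CycHam_basis (contract \<Delta> ?I)"
      by (rule basis_CycHam_relabel[OF simple_graph_contract verts_contract_nonempty(1)[OF \<Gamma> zs(1)]
            graph_partition.simple_graph_contract[OF graph_partition_relabel[OF simple_\<Delta> f]]
            graph_iso_contract_relabel[OF simple_\<Delta> f]])
    then have "relabel ?N f x \<in> basis ?N \<Delta>"
      unfolding rel mem_composite_iff[OF \<Delta>]
      using graph_partition_relabel[OF simple_\<Delta> f] block_orderings_relabel[OF simple_\<Delta> f zs(4)] by simp
    moreover have "subst_cyc ?c ?s = map f ` subst_cyc c s"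
    proof -
      have "set zs \<subseteq> blk ` I" using zs(2) by (simp add: orderings_def verts_contract)
      from subst_list_relabel[OF simple_\<Delta> f this, of s] show ?thesis
        unfolding zs(3) map_cyc subst_cyc_cyc by simp
    qed
    ultimately show "relabel ?N f x \<in> basis ?N \<Delta> \<and> ?\<psi> (relabel ?N f x) = relabel CycPerm_basis f (?\<psi> x)"
      unfolding rel by (simp add: Ics CycPerm_basis_def)
  qed
next
  fix \<Gamma> :: "'a vgraph" and I
  let ?N = "composite CycHam_basis PlanEq_basis :: ('a, _, _) bmodule"
  let ?\<psi> = "\<lambda>(I :: 'a vert set set, c, s). subst_cyc c s"
  assume "connected_graph \<Gamma> \<and> tube_partition \<Gamma> I"
  then have \<Gamma>: "connected_graph \<Gamma>" and I: "tube_partition \<Gamma> I" by simp_all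
  interpret graph_partition \<Gamma> I by (rule graph_partition_of_tubes[OF \<Gamma> I])
  show "\<forall>x\<in>basis ?N (contract \<Gamma> I). \<forall>p\<in>\<Pi>\<^sub>E G\<in>I. basis PlanEq_basis (induced \<Gamma> G).
    bact ?N \<Gamma> I x p \<in> basis ?N \<Gamma> \<and> ?\<psi> (bact ?N \<Gamma> I x p) = bact CycPerm_basis \<Gamma> I (?\<psi> x) p"
  proof (intro ballI)
    fix x p assume x: "x \<in> basis ?N (contract \<Gamma> I)"
      and p: "p \<in> (\<Pi>\<^sub>E G\<in>I. basis PlanEq_basis (induced \<Gamma> G))"
    obtain J c s where Jcs: "x = (J, c, s)" by (cases x)
    note x = x[unfolded Jcs]
    note contract = connected_contract[OF \<Gamma> I]
    obtain zs where zs: "graph_partition (contract \<Gamma> I) J" "zs \<in> orderings (contract (contract \<Gamma> I) J)"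
      "c = cyc zs" "graph_partition.block_orderings (contract \<Gamma> I) J s"
      using composite_cases[OF contract x] by metis
    have p: "block_orderings p" using p mem_PiE_plan_orderings_iff by (simp add: PlanEq_basis_def)
    note J = graph_partition.part[OF zs(1)]
    let ?J = "flatten ` J" and ?c = "map (on_blocks flatten) ` c"
      and ?s = "\<lambda>H\<in>flatten ` J. let C = inv_into J flatten H; I' = {G \<in> I. blk G \<in> C}
        in subst_list (s C) (restrict p I')"
    have act: "bact ?N \<Gamma> I x p = (?J, ?c, ?s)"
      by (simp add: Jcs composite_def PlanEq_basis_def CycHam_basis_def)
    have "c \<in> basis CycHam_basis (contract (contract \<Gamma> I) J)"
      using x by (simp add: mem_composite_iff[OF contract])
    \<comment> \<open>The cycle keeps its shape; its vertices, which stand for blocks of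
      \<open>J\<close>, are renamed along the isomorphism from the iterated contraction to the
      contraction by the flattened partition.\<close>
    then have "?c \<in> basis CycHam_basis (contract \<Gamma> ?J)"
      by (rule basis_CycHam_relabel[OF graph_partition.simple_graph_contract[OF zs(1)]
            verts_contract_nonempty(1)[OF contract zs(1)]
            graph_partition.simple_graph_contract[OF graph_partition_flatten[OF J]]
            graph_iso_contract_flatten[OF J]])
    then have "bact ?N \<Gamma> I x p \<in> basis ?N \<Gamma>"
      unfolding act mem_composite_iff[OF \<Gamma>]
      using graph_partition_flatten[OF J] block_orderings_composed[OF J zs(4) p] by simp
    moreover have "subst_cyc ?c ?s = subst_cyc (subst_cyc c s) p"
    proof -
      have "set zs \<subseteq> blk ` J" using zs(2) by (simp add: orderings_def verts_contract)
      from subst_list_subst_list[OF J zs(4) p this] show ?thesis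
        unfolding zs(3) map_cyc subst_cyc_cyc by simp
    qed
    ultimately show "bact ?N \<Gamma> I x p \<in> basis ?N \<Gamma> \<and>
        ?\<psi> (bact ?N \<Gamma> I x p) = bact CycPerm_basis \<Gamma> I (?\<psi> x) p"
      unfolding act by (simp add: Jcs CycPerm_basis_def)
  qed
qed

theorem theorem3p4p2:
  "rmodule_isomorphic (PlanEq :: ('a, 'k::field, 'a vert list \<Rightarrow>\<^sub>0 'k) contractad)
     CycPerm (direct_sum CycEq CycHam_PlanEq)"
  unfolding PlanEq_def CycPerm_def CycEq_def CycHam_PlanEq_def
proof (rule rmodule_isomorphic_complementary_embeddings[OF CycEq_embedding CycHam_embedding])
  fix \<Gamma> :: "'a vgraph" assume \<Gamma>: "connected_graph \<Gamma>"
  let ?N = "basis (composite CycHam_basis PlanEq_basis) \<Gamma>" and ?\<psi> = "\<lambda>(I, c, s). subst_cyc c s"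
  have CycEq: "basis CycEq_basis \<Gamma> = {c \<in> cyclic_orderings \<Gamma>. \<exists>xs\<in>c. xs \<in> plan_orderings \<Gamma>}"
    and CycPerm: "basis CycPerm_basis \<Gamma> = cyclic_orderings \<Gamma>"
    by (simp_all add: CycEq_basis_def CycPerm_basis_def)
  have cyclic: "subst_cyc c s \<in> cyclic_orderings \<Gamma>" if x: "(I, c, s) \<in> ?N" for I c s
  proof -
    obtain zs where zs: "graph_partition \<Gamma> I" "zs \<in> orderings (contract \<Gamma> I)" "c = cyc zs"
      "graph_partition.block_orderings \<Gamma> I s"
      using composite_cases[OF \<Gamma> x] by metis
    from zs(1) interpret graph_partition \<Gamma> I .
    have "subst_list zs s \<in> orderings \<Gamma>"
      by (rule subst_list_ordering[OF zs(2)]) (simp add: block_orderingsD[OF zs(4)])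
    then show ?thesis by (simp add: zs(3) subst_cyc_cyc cyclic_orderings_def)
  qed
  show "(\<lambda>x. x) ` basis CycEq_basis \<Gamma> \<union> ?\<psi> ` ?N = basis CycPerm_basis \<Gamma>"
  proof (intro subset_antisym subsetI)
    fix c assume "c \<in> (\<lambda>x. x) ` basis CycEq_basis \<Gamma> \<union> ?\<psi> ` ?N"
    then show "c \<in> basis CycPerm_basis \<Gamma>" using cyclic by (auto simp: CycEq CycPerm)
  next
    fix c assume c: "c \<in> basis CycPerm_basis \<Gamma>"
    show "c \<in> (\<lambda>x. x) ` basis CycEq_basis \<Gamma> \<union> ?\<psi> ` ?N"
    \<comment> \<open>An ordering with an admissible representative comes from \<open>CycEq\<close>,
      every other one from a decomposition.\<close>
    proof (cases "\<exists>xs\<in>c. xs \<in> plan_orderings \<Gamma>")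
      case True
      then show ?thesis using c by (simp add: CycEq CycPerm)
    next
      case False
      then obtain I d s where "(I, d, s) \<in> ?N" "subst_cyc d s = c"
        using decomposition_exists[OF \<Gamma>, of c] c CycPerm by blast
      then show ?thesis by force
    qed
  qed
  show "(\<lambda>x. x) ` basis CycEq_basis \<Gamma> \<inter> ?\<psi> ` ?N = {}"
    using decomposition_not_plan[OF \<Gamma>] by (auto simp: CycEq)
qed

end
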